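(* Let $c,d>0$ and consider proper biharmonic solutions of the boundary value problem $$\varphi_\beta:\overline{B^4(1/c^2)}\to S^4(d^2),\qquad \beta\big(\ln(1/c^2)\big)=\frac{\pi}{2d}.$$ The conformal, rotationally symmetric, proper biharmonic solution $\varphi_\beta$ defined by $$\beta(t)=\frac2d\arctan(c^2e^t),\qquad t\le\ln(1/c^2),$$ is equivariant stable with respect to variations which preserve the boundary data.
   Context: $\overline{B^4(1/c^2)}$ is the closed ball of radius $1/c^2$ centred at the origin in $\mathbb{R}^4$, and $S^4(d^2)$ is the sphere of constant curvature $d^2$, written in geodesic polar coordinates $(\theta,\alpha)$, $\theta\in S^3$, $0\le\alpha\le\pi/d$, with metric $h^2(\alpha)g_{S^3}+d\alpha^2$, $h(\alpha)=\frac1d\sin(d\alpha)$. A rotationally symmetric map is of the form $(\theta,r)\mapsto(\theta,\alpha(r))$ in polar coordinates, with $\alpha(0)=0$; writing $r=e^t$ and $\beta(t)=\alpha(e^t)$, the map is denoted $\varphi_\beta$. A map is proper biharmonic if it is a critical point of the bienergy $\frac12\int|\tau(\varphi)|^2dv_g$, where $\tau(\varphi)=\operatorname{trace}\nabla d\varphi$, but $\tau(\varphi)\not\equiv0$. Up to an irrelevant positive constant factor, the bienergy of $\varphi_\beta$ is $$E_2(\varphi_\beta)=\frac12\int\left[\ddot\beta+2\dot\beta-3q(\beta)\right]^2dt,\qquad q(\beta)=h(\beta)h'(\beta),$$ the integral being over the domain $(-\infty,\ln(1/c^2)]$ of $\beta$ (when computing variations with compactly supported $V$, the integral is understood over compact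 sets containing the support of $V$). Equivariant stable with respect to variations which preserve the boundary data means that $$\nabla^2E_2(\varphi_\beta)(\mathcal V,\mathcal V)=\frac{d^2E_2(\varphi_{\beta+sV})}{ds^2}\Big|_{s=0}>0$$ for all smooth vector fields $\mathcal V=V(t)\,\partial/\partial\beta$ where $V\not\equiv0$ is a real-valued smooth function, compactly supported in $(-\infty,\ln(1/c^2)]$, with $V(\ln(1/c^2))=\dot V(\ln(1/c^2))=0$. *)

theory Defs
  imports "HOL-Analysis.Analysis"
begin

section \<open>Smooth maps\<close>

text \<open>On open sets this is the usual class \<open>C\<^sup>k\<close>.\<close>

primrec Ck_on :: "nat \<Rightarrow> 'a::euclidean_space set \<Rightarrow> ('a \<Rightarrow> 'b::euclidean_space) \<Rightarrow> bool" where
  "Ck_on 0 U f \<longleftrightarrow> continuous_on U f"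
| "Ck_on (Suc k) U f \<longleftrightarrow>
     f differentiable_on U \<and> (\<forall>v. Ck_on k U (\<lambda>x. frechet_derivative f (at x) v))"

text \<open>A map on an arbitrary (e.g. closed) set is smooth if it is the restriction of a smooth map
  defined on an open neighbourhood.\<close>

definition smooth_on :: "'a::euclidean_space set \<Rightarrow> ('a \<Rightarrow> 'b::euclidean_space) \<Rightarrow> bool" where
  "smooth_on S f \<longleftrightarrow> (\<exists>U g. open U \<and> S \<subseteq> U \<and> (\<forall>k. Ck_on k U g) \<and> (\<forall>x\<in>S. g x = f x))"


section \<open>The sphere of curvature \<open>d\<^sup>2\<close> and maps into it\<close>

text \<open>The sphere \<open>S\<^sup>4(d\<^sup>2)\<close> is modelled isometrically as the sphere of radius \<open>1 / d\<close> in
  \<open>\<real>\<^sup>4 \<times> \<real> = \<real>\<^sup>5\<close>. The map \<open>polar d\<close> is its geodesic polar coordinate system about the pole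
  \<open>(0, 1 / d)\<close>: the pulled back metric is \<open>h\<^sup>2(\<alpha>) g + d\<alpha>\<^sup>2\<close>, where \<open>g\<close> is the metric of \<open>S\<^sup>3\<close>.\<close>

definition h :: "real \<Rightarrow> real \<Rightarrow> real" where
  "h d \<alpha> = sin (d * \<alpha>) / d"

definition polar :: "real \<Rightarrow> real^4 \<Rightarrow> real \<Rightarrow> (real^4) \<times> real" where
  "polar d \<theta> \<alpha> = (h d \<alpha> *\<^sub>R \<theta>, cos (d * \<alpha>) / d)"

text \<open>The rotationally symmetric map \<open>(\<theta>, r) \<mapsto> (\<theta>, \<alpha>(r))\<close> with \<open>\<alpha>(0) = 0\<close> and
  \<open>\<alpha>(r) = \<beta>(ln r)\<close>; here \<open>\<theta> = sgn x = x / norm x\<close> and \<open>r = norm x\<close>.\<close>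

definition rot_map :: "real \<Rightarrow> (real \<Rightarrow> real) \<Rightarrow> real^4 \<Rightarrow> (real^4) \<times> real" where
  "rot_map d \<beta> x = polar d (sgn x) (if x = 0 then 0 else \<beta> (ln (norm x)))"

definition conformal_on :: "'a::euclidean_space set \<Rightarrow> ('a \<Rightarrow> 'b::euclidean_space) \<Rightarrow> bool" where
  "conformal_on M \<phi> \<longleftrightarrow> (\<forall>x\<in>M. \<exists>D \<rho>. (\<phi> has_derivative D) (at x within M) \<and> \<rho> > 0 \<and>
     (\<forall>u v. D u \<bullet> D v = \<rho>\<^sup>2 * (u \<bullet> v)))"

text \<open>Orthogonal projection of \<open>w\<close> onto the tangent space at \<open>y\<close> of the sphere of radius \<open>1 / d\<close>.
  Covariant derivatives on the sphere are tangential projections of flat derivatives, so the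
  second fundamental form of \<open>\<phi>\<close> is \<open>(\<nabla>d\<phi>)(b, b) = tangent_proj d (\<phi> x) (\<partial>\<^sub>b \<partial>\<^sub>b \<phi>)\<close>, and the
  tension field is its trace. It is only used at interior points of the domain of \<open>\<phi>\<close>.\<close>

definition tangent_proj :: "real \<Rightarrow> 'b::euclidean_space \<Rightarrow> 'b \<Rightarrow> 'b" where
  "tangent_proj d y w = w - (d\<^sup>2 * (w \<bullet> y)) *\<^sub>R y"

definition tension :: "real \<Rightarrow> ('a::euclidean_space \<Rightarrow> 'b::euclidean_space) \<Rightarrow> 'a \<Rightarrow> 'b" where
  "tension d \<phi> x = (\<Sum>b\<in>Basis. tangent_proj d (\<phi> x)
     (frechet_derivative (\<lambda>y. frechet_derivative \<phi> (at y) b) (at x) b))"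

definition bienergy :: "real \<Rightarrow> 'a::euclidean_space set \<Rightarrow> ('a \<Rightarrow> 'b::euclidean_space) \<Rightarrow> real" where
  "bienergy d U \<phi> = 1/2 * (LINT x:U|lborel. (norm (tension d \<phi> x))\<^sup>2)"

text \<open>Smooth variations \<open>\<Phi>\<^sub>s\<close> (for \<open>\<bar>s\<bar> < \<epsilon>\<close>) of \<open>\<phi>\<close> on the open set \<open>U\<close>, through maps into the
  sphere, that are fixed outside a compact subset of \<open>U\<close>.\<close>

definition variation ::
  "real \<Rightarrow> 'a::euclidean_space set \<Rightarrow> ('a \<Rightarrow> 'b::euclidean_space) \<Rightarrow> (real \<Rightarrow> 'a \<Rightarrow> 'b) \<Rightarrow> real \<Rightarrow> bool"
where
  "variation d U \<phi> \<Phi> \<epsilon> \<longleftrightarrow> \<epsilon> > 0 \<and>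
     smooth_on ({-\<epsilon><..<\<epsilon>} \<times> U) (\<lambda>(s, x). \<Phi> s x) \<and>
     (\<forall>s\<in>{-\<epsilon><..<\<epsilon>}. \<forall>x\<in>U. \<Phi> s x \<in> sphere 0 (1 / d)) \<and>
     (\<forall>x\<in>U. \<Phi> 0 x = \<phi> x) \<and>
     (\<exists>K. compact K \<and> K \<subseteq> U \<and> (\<forall>s\<in>{-\<epsilon><..<\<epsilon>}. \<forall>x\<in>U - K. \<Phi> s x = \<phi> x))"

text \<open>The domain \<open>M\<close> is allowed to have a boundary (of measure zero); variations are compactly
  supported in the interior.\<close>

definition proper_biharmonic ::
  "real \<Rightarrow> 'a::euclidean_space set \<Rightarrow> ('a \<Rightarrow> 'b::euclidean_space) \<Rightarrow> bool" where
  "proper_biharmonic d M \<phi> \<longleftrightarrow>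
     smooth_on M \<phi> \<and> \<phi> ` M \<subseteq> sphere 0 (1 / d) \<and>
     (\<forall>\<Phi> \<epsilon>. variation d (interior M) \<phi> \<Phi> \<epsilon> \<longrightarrow>
        ((\<lambda>s. bienergy d (interior M) (\<Phi> s)) has_real_derivative 0) (at 0)) \<and>
     (\<exists>x\<in>interior M. tension d \<phi> x \<noteq> 0)"


section \<open>Equivariant second variation\<close>

definition q :: "real \<Rightarrow> real \<Rightarrow> real" where
  "q d \<alpha> = h d \<alpha> * deriv (h d) \<alpha>"

text \<open>Derivative on the half line \<open>(-\<infinity>, T]\<close>, one-sided at the endpoint \<open>T\<close>.\<close>

definition ddt :: "real \<Rightarrow> (real \<Rightarrow> real) \<Rightarrow> real \<Rightarrow> real" where
  "ddt T f t = vector_derivative f (at t within {..T})"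

text \<open>The bienergy of \<open>rot_map d \<beta>\<close>, up to a positive constant factor, as an integral over
  \<open>K \<subseteq> (-\<infinity>, T]\<close> in the variable \<open>t = ln r\<close>.\<close>

definition E2 :: "real \<Rightarrow> real \<Rightarrow> real set \<Rightarrow> (real \<Rightarrow> real) \<Rightarrow> real" where
  "E2 d T K \<beta> = 1/2 * (LINT t:K|lborel. (ddt T (ddt T \<beta>) t + 2 * ddt T \<beta> t - 3 * q d (\<beta> t))\<^sup>2)"

definition has_second_derivative :: "(real \<Rightarrow> real) \<Rightarrow> real \<Rightarrow> real \<Rightarrow> bool" where
  "has_second_derivative F D x \<longleftrightarrow> (\<exists>F'.
     (\<forall>\<^sub>F s in nhds x. (F has_real_derivative F' s) (at s)) \<and> (F' has_real_derivative D) (at x))"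

definition support_in :: "real \<Rightarrow> (real \<Rightarrow> real) \<Rightarrow> real set" where
  "support_in T V = closure {t. t \<le> T \<and> V t \<noteq> 0}"

text \<open>The integral in \<open>E2\<close> is taken over an arbitrary compact set \<open>K\<close> containing the support of \<open>V\<close>.\<close>

definition equivariant_stable :: "real \<Rightarrow> real \<Rightarrow> (real \<Rightarrow> real) \<Rightarrow> bool" where
  "equivariant_stable d T \<beta> \<longleftrightarrow>
     (\<forall>V. smooth_on {..T} V \<and> (\<exists>t\<le>T. V t \<noteq> 0) \<and> compact (support_in T V) \<and>
          V T = 0 \<and> ddt T V T = 0 \<longrightarrow>
       (\<forall>K. compact K \<and> support_in T V \<subseteq> K \<and> K \<subseteq> {..T} \<longrightarrow>
         (\<exists>D>0. has_second_derivative (\<lambda>s. E2 d T K (\<lambda>t. \<beta> t + s * V t)) D 0)))"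

end

theory Submission
  imports Defs "HOL-Computational_Algebra.Polynomial"
begin

text \<open>
  Write \<open>\<kappa> = c\<^sup>2\<close> and \<open>w(x) = 1 / (1 + \<kappa>\<^sup>2 |x|\<^sup>2)\<close>. By the half-angle formulas the map with profile
  \<open>\<beta>(t) = (2 / d) arctan (\<kappa> e\<^sup>t)\<close> is inverse stereographic projection
  \<open>x \<mapsto> (2 \<kappa> w x, 2 w - 1) / d\<close>, restricted to the closed ball whose image is a hemisphere. Hence it is
  smooth and conformal, with factor \<open>2 \<kappa> w / d\<close>. Moreover \<open>\<phi>\<close>, its tension field \<open>\<tau>\<close> and \<open>\<Delta>\<tau>\<close> all have
  the form \<open>(p(w) x, r(w))\<close> with polynomials \<open>p\<close> and \<open>r\<close>, and the Laplacian acts on such pairs by an explicit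
  ordinary differential operator (\<open>laplacian_radial\<close>). In dimension 4 this gives \<open>\<tau> \<noteq> 0\<close> away from
  the origin, together with the biharmonic equation: the tangential part of \<open>\<Delta>\<tau>\<close> is
  \<open>d\<^sup>2 \<langle>\<Delta>\<phi>, \<phi>\<rangle> \<tau>\<close> (\<open>inv_stereo_biharmonic\<close>).

  That the biharmonic equation makes \<open>\<phi>\<close> critical for arbitrary, not only rotationally symmetric,
  variations \<open>\<Phi>\<^sub>s\<close> is \<open>first_variation_eq_0\<close>. Put \<open>X = \<Phi>\<^sub>s - \<phi>\<close>, in the ambient vector space. Since
  \<open>|\<tau>(\<Phi>)|\<^sup>2 = |\<Delta>\<Phi>|\<^sup>2 - d\<^sup>2 \<langle>\<Delta>\<Phi>, \<Phi>\<rangle>\<^sup>2\<close> is polynomial in \<open>\<Phi>\<close> and \<open>\<Delta>\<Phi>\<close>, its increment is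
  an expression linear in \<open>X\<close> and \<open>\<Delta>X\<close> plus a remainder of second order. Both \<open>X\<close> and \<open>\<Delta>X\<close> are
  \<open>O(s)\<close> uniformly, so the remainder is \<open>O(s\<^sup>2)\<close>. Green's identity turns the integral of the linear part into the
  integral of \<open>\<langle>\<Delta>\<tau> - d\<^sup>2 \<langle>\<Delta>\<phi>, \<phi>\<rangle> \<Delta>\<phi>, X\<rangle>\<close>, and the biharmonic equation says that the left factor is
  \<open>\<mu> \<phi>\<close> for a scalar function \<open>\<mu>\<close>. As \<open>\<phi>\<close> and \<open>\<phi> + X\<close> lie on one sphere,
  \<open>\<langle>\<phi>, X\<rangle> = - |X|\<^sup>2 / 2\<close>, which is \<open>O(s\<^sup>2)\<close> as well. So the bienergy changes by \<open>O(s\<^sup>2)\<close> only, and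
  its derivative vanishes; this argument does not differentiate under the integral sign.

  For stability (\<open>conformal_profile_stable\<close>), put \<open>S = sin (d \<beta>)\<close> and \<open>C = cos (d \<beta>)\<close>. Differentiating the
  squared integrand twice at \<open>s = 0\<close> gives
  \<open>(V'' + 2 V' - 3 q'(\<beta>) V)\<^sup>2 + 6 d sin (2 d \<beta>) (\<beta>'' + 2 \<beta>' - 3 q(\<beta>)) V\<^sup>2\<close>. The profile satisfies
  \<open>\<beta>' = S / d\<close> and \<open>\<beta>'' = q(\<beta>)\<close>, so the second summand equals \<open>24 S\<^sup>2 C (1 - C) V\<^sup>2\<close>. The ball is mapped
  to a hemisphere, that is \<open>0 < d \<beta> < \<pi> / 2\<close> before the boundary, and therefore this summand is nonnegative, and
  positive wherever \<open>V\<close> does not vanish in the interior.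
\<close>

section \<open>Calculus of \<open>C\<^sup>k\<close> maps\<close>

lemma frechet_derivative_cong_open:
  assumes "open U" "x \<in> U" "\<And>y. y \<in> U \<Longrightarrow> f y = g y"
  shows "frechet_derivative f (at x) = frechet_derivative g (at x)"
proof -
  have "(f has_derivative D) (at x) \<longleftrightarrow> (g has_derivative D) (at x)" for D
    using assms has_derivative_transform_within_open[of f D x UNIV U g]
      has_derivative_transform_within_open[of g D x UNIV U f] by auto
  then show ?thesis
    unfolding frechet_derivative_def by simp
qed

lemma Ck_on_cong:
  assumes "open U" "Ck_on k U f" "\<And>x. x \<in> U \<Longrightarrow> f x = g x"
  shows "Ck_on k U g"
  using assms(2,3)
proof (induction k arbitrary: f g)
  case 0
  then show ?case
    by (metis Ck_on.simps(1) continuous_on_cong)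
next
  case (Suc k)
  have "g differentiable_on U"
    using Suc.prems differentiable_transform_within[of f _ U 1 g]
    by (simp add: differentiable_on_def)
  moreover have "Ck_on k U (\<lambda>x. frechet_derivative g (at x) v)" for v
  proof (rule Suc.IH)
    show "Ck_on k U (\<lambda>x. frechet_derivative f (at x) v)"
      using Suc.prems by simp
    show "frechet_derivative f (at x) v = frechet_derivative g (at x) v" if "x \<in> U" for x
      using frechet_derivative_cong_open[OF assms(1) that Suc.prems(2)] by simp
  qed
  ultimately show ?case
    by simp
qed

lemma Ck_on_differentiable_at:
  assumes "open U" "Ck_on (Suc k) U f" "x \<in> U"
  shows "(f has_derivative frechet_derivative f (at x)) (at x)"
  using assms by (simp add: differentiable_on_eq_differentiable_at frechet_derivative_works[symmetric])

lemma Ck_on_imp_continuous_on: "Ck_on k U f \<Longrightarrow> continuous_on U f"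
  by (cases k) (auto intro: differentiable_imp_continuous_on)

lemma frechet_derivative_diff_apply:
  assumes "open U" "Ck_on (Suc k) U f" "Ck_on (Suc k) U g" "x \<in> U"
  shows "frechet_derivative (\<lambda>x. f x - g x) (at x) v
    = frechet_derivative f (at x) v - frechet_derivative g (at x) v"
  using has_derivative_diff[OF Ck_on_differentiable_at[OF assms(1,2,4)]
      Ck_on_differentiable_at[OF assms(1,3,4)]]
  by (simp flip: frechet_derivative_at)

lemma Ck_on_diff:
  assumes "open U" "Ck_on k U f" "Ck_on k U g"
  shows "Ck_on k U (\<lambda>x. f x - g x)"
  using assms(2,3)
proof (induction k arbitrary: f g)
  case 0
  then show ?case
    by (auto intro: continuous_on_diff)
next
  case (Suc k)
  have "Ck_on k U (\<lambda>x. frechet_derivative (\<lambda>x. f x - g x) (at x) v)" for v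
  proof (rule Ck_on_cong[OF assms(1)])
    show "Ck_on k U (\<lambda>x. frechet_derivative f (at x) v - frechet_derivative g (at x) v)"
      using Suc by auto
    show "frechet_derivative f (at x) v - frechet_derivative g (at x) v
        = frechet_derivative (\<lambda>x. f x - g x) (at x) v" if "x \<in> U" for x
      using frechet_derivative_diff_apply[OF assms(1) Suc.prems that] by simp
  qed
  then show ?case
    using Suc.prems by (auto intro: differentiable_on_diff)
qed

lemma slice_has_derivative:
  assumes "(G has_derivative D) (at (s, x))"
  shows "((\<lambda>y. G (s, y)) has_derivative (\<lambda>v. D (0, v))) (at x)"
proof -
  have "((\<lambda>y. (s, y)) has_derivative (\<lambda>v. (0, v))) (at x)"
    by (auto intro!: derivative_eq_intros)
  then show ?thesis
    by (rule has_derivative_compose) (use assms in simp)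
qed

text \<open>A variation is jointly smooth in \<open>(s, x)\<close>; its members inherit their regularity from this, and
  their derivatives are derivatives of the joint map in the directions \<open>(0, v)\<close>.\<close>

lemma Ck_on_slice:
  assumes "open W" "open U" "Ck_on k W G" "{s} \<times> U \<subseteq> W"
  shows "Ck_on k U (\<lambda>x. G (s, x))"
  using assms(3)
proof (induction k arbitrary: G)
  case 0
  show ?case
    using 0 assms(4) by (auto intro!: continuous_on_compose2[of W G] continuous_intros)
next
  case (Suc k)
  have der: "((\<lambda>y. G (s, y)) has_derivative (\<lambda>v. frechet_derivative G (at (s, x)) (0, v))) (at x)"
    if "x \<in> U" for x
    using slice_has_derivative[OF Ck_on_differentiable_at[OF assms(1) Suc.prems]] assms(4) that by blast
  have "Ck_on k U (\<lambda>x. frechet_derivative (\<lambda>x. G (s, x)) (at x) v)" for v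
  proof (rule Ck_on_cong[OF assms(2)])
    show "Ck_on k U (\<lambda>x. frechet_derivative G (at (s, x)) (0, v))"
      using Suc.IH[of "\<lambda>z. frechet_derivative G (at z) (0, v)"] Suc.prems by simp
    show "frechet_derivative G (at (s, x)) (0, v) = frechet_derivative (\<lambda>x. G (s, x)) (at x) v"
      if "x \<in> U" for x
      using frechet_derivative_at[OF der[OF that]] by metis
  qed
  moreover have "(\<lambda>x. G (s, x)) differentiable_on U"
    using der by (auto simp: differentiable_on_eq_differentiable_at[OF assms(2)] differentiable_def)
  ultimately show ?case
    by simp
qed

section \<open>The Laplacian and the tension field\<close>

definition laplacian :: "('a::euclidean_space \<Rightarrow> 'b::euclidean_space) \<Rightarrow> 'a \<Rightarrow> 'b" where
  "laplacian f x = (\<Sum>b\<in>Basis. frechet_derivative (\<lambda>y. frechet_derivative f (at y) b) (at x) b)"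

text \<open>The tangential projection is linear, so it can be taken after the trace.\<close>

lemma tension_eq: "tension d \<phi> x = tangent_proj d (\<phi> x) (laplacian \<phi> x)"
  by (simp add: tension_def laplacian_def tangent_proj_def sum_subtractf inner_sum_left
      sum_distrib_left scaleR_sum_left)

lemma laplacian_cong_open:
  assumes "open U" "x \<in> U" "\<And>y. y \<in> U \<Longrightarrow> f y = g y"
  shows "laplacian f x = laplacian g x"
proof -
  have first: "frechet_derivative f (at y) b = frechet_derivative g (at y) b" if "y \<in> U" for y b
    using frechet_derivative_cong_open[OF assms(1) that assms(3)] by simp
  show ?thesis
    unfolding laplacian_def using frechet_derivative_cong_open[OF assms(1,2) first] by simp
qed

lemma laplacian_diff:
  assumes U: "open U" and x: "x \<in> U" and f: "Ck_on (Suc (Suc k)) U f" and g: "Ck_on (Suc (Suc k)) U g"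
  shows "laplacian (\<lambda>y. f y - g y) x = laplacian f x - laplacian g x"
proof -
  have "frechet_derivative (\<lambda>y. frechet_derivative (\<lambda>y. f y - g y) (at y) b) (at x) b
      = frechet_derivative (\<lambda>y. frechet_derivative f (at y) b) (at x) b
       - frechet_derivative (\<lambda>y. frechet_derivative g (at y) b) (at x) b" for b
  proof -
    have 1: "frechet_derivative (\<lambda>y. f y - g y) (at y) b
        = frechet_derivative f (at y) b - frechet_derivative g (at y) b" if "y \<in> U" for y
      by (rule frechet_derivative_diff_apply[OF U f g that])
    have "frechet_derivative (\<lambda>y. frechet_derivative (\<lambda>y. f y - g y) (at y) b) (at x) b
        = frechet_derivative (\<lambda>y. frechet_derivative f (at y) b - frechet_derivative g (at y) b) (at x) b"
      using frechet_derivative_cong_open[OF U x 1] by simp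
    also have "\<dots> = frechet_derivative (\<lambda>y. frechet_derivative f (at y) b) (at x) b
       - frechet_derivative (\<lambda>y. frechet_derivative g (at y) b) (at x) b"
      using f g by (intro frechet_derivative_diff_apply[OF U _ _ x, of k]) auto
    finally show ?thesis .
  qed
  then show ?thesis
    by (simp add: laplacian_def sum_subtractf)
qed

lemma Ck_on_laplacian_continuous:
  assumes "Ck_on (Suc (Suc k)) U f"
  shows "continuous_on U (laplacian f)"
  unfolding laplacian_def[abs_def]
  by (intro continuous_on_sum Ck_on_imp_continuous_on[of k]) (use assms in simp)

section \<open>Smoothness of functions of the stereographic weight\<close>

text \<open>This is the rational function through which stereographic projection depends on the norm.
  For \<open>\<kappa> = 1\<close>, \<open>2 weight\<close> is the conformal factor of the round sphere in stereographic coordinates.\<close>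

definition weight :: "real \<Rightarrow> 'a::real_inner \<Rightarrow> real" where
  "weight \<kappa> x = 1 / (1 + \<kappa>\<^sup>2 * (x \<bullet> x))"

lemma weight_denominator_pos: "1 + \<kappa>\<^sup>2 * (x \<bullet> x) > 0"
  by (smt (verit) inner_ge_zero mult_nonneg_nonneg zero_le_power2)

lemma weight_has_derivative:
  "(weight \<kappa> has_derivative (\<lambda>v. - 2 * \<kappa>\<^sup>2 * (weight \<kappa> x)\<^sup>2 * (x \<bullet> v))) (at x)"
proof -
  have "1 + \<kappa>\<^sup>2 * (x \<bullet> x) \<noteq> 0"
    using weight_denominator_pos[of \<kappa> x] by simp
  then show ?thesis
    unfolding weight_def[abs_def]
    by (auto intro!: derivative_eq_intros simp: fun_eq_iff field_simps power2_eq_square inner_commute)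
qed

text \<open>Smoothness of all orders follows from closure under directional derivatives. This is the smallest
  algebra that contains the coordinates and the weight, and it is closed because the derivative of \<open>w\<close> in direction
  \<open>v\<close> is \<open>- 2 \<kappa>\<^sup>2 w\<^sup>2 (x \<bullet> v)\<close>.\<close>

inductive_set weight_algebra :: "real \<Rightarrow> ('a::euclidean_space \<Rightarrow> real) set" for \<kappa> where
  const: "(\<lambda>x. a) \<in> weight_algebra \<kappa>"
| coord: "(\<lambda>x. x \<bullet> b) \<in> weight_algebra \<kappa>"
| weight: "weight \<kappa> \<in> weight_algebra \<kappa>"
| add: "f \<in> weight_algebra \<kappa> \<Longrightarrow> g \<in> weight_algebra \<kappa> \<Longrightarrow> (\<lambda>x. f x + g x) \<in> weight_algebra \<kappa>"
| mult: "f \<in> weight_algebra \<kappa> \<Longrightarrow> g \<in> weight_algebra \<kappa> \<Longrightarrow> (\<lambda>x. f x * g x) \<in> weight_algebra \<kappa>"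

lemma weight_algebra_derivative:
  assumes "f \<in> weight_algebra \<kappa>"
  shows "\<exists>f'. (\<forall>x. (f has_derivative f' x) (at x)) \<and> (\<forall>v. (\<lambda>x. f' x v) \<in> weight_algebra \<kappa>)"
  using assms
proof induction
  case (const a)
  show ?case
    by (intro exI[of _ "\<lambda>x v. 0"]) (auto intro: weight_algebra.const)
next
  case (coord b)
  show ?case
    by (intro exI[of _ "\<lambda>x v. v \<bullet> b"])
      (auto intro: weight_algebra.const bounded_linear.has_derivative[OF bounded_linear_inner_left, OF has_derivative_ident])
next
  case weight
  have "(\<lambda>x. ((- 2 * \<kappa>\<^sup>2) * (weight \<kappa> x * weight \<kappa> x)) * (x \<bullet> v)) \<in> weight_algebra \<kappa>" for v :: 'a
    by (intro weight_algebra.intros)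
  moreover have "(weight \<kappa> has_derivative (\<lambda>v. - 2 * \<kappa>\<^sup>2 * (weight \<kappa> x)\<^sup>2 * (x \<bullet> v))) (at x)" for x :: 'a
    by (rule weight_has_derivative)
  ultimately show ?case
    by (intro exI[of _ "\<lambda>x v. - 2 * \<kappa>\<^sup>2 * (weight \<kappa> x)\<^sup>2 * (x \<bullet> v)"])
      (simp add: power2_eq_square)
next
  case (add f g)
  then obtain f' g' where "\<And>x. (f has_derivative f' x) (at x)" "\<And>v. (\<lambda>x. f' x v) \<in> weight_algebra \<kappa>"
    "\<And>x. (g has_derivative g' x) (at x)" "\<And>v. (\<lambda>x. g' x v) \<in> weight_algebra \<kappa>"
    by blast
  then show ?case
    by (intro exI[of _ "\<lambda>x v. f' x v + g' x v"]) (simp add: has_derivative_add weight_algebra.add)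
next
  case (mult f g)
  then obtain f' g' where "\<And>x. (f has_derivative f' x) (at x)" "\<And>v. (\<lambda>x. f' x v) \<in> weight_algebra \<kappa>"
    "\<And>x. (g has_derivative g' x) (at x)" "\<And>v. (\<lambda>x. g' x v) \<in> weight_algebra \<kappa>"
    by blast
  then show ?case using mult.hyps
    by (intro exI[of _ "\<lambda>x v. f x * g' x v + f' x v * g x"])
      (simp add: has_derivative_mult weight_algebra.add weight_algebra.mult)
qed

lemma Ck_on_weight_algebra:
  fixes F :: "'a::euclidean_space \<Rightarrow> 'b::euclidean_space"
  assumes "\<And>b. b \<in> Basis \<Longrightarrow> (\<lambda>x. F x \<bullet> b) \<in> weight_algebra \<kappa>"
  shows "Ck_on k U F"
  using assms
proof (induction k arbitrary: F)
  have *: "\<exists>F'. (\<forall>x. (F has_derivative F' x) (at x)) \<and>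
      (\<forall>v. \<forall>b\<in>Basis. (\<lambda>x. F' x v \<bullet> b) \<in> weight_algebra \<kappa>)"
    if F: "\<And>b. b \<in> Basis \<Longrightarrow> (\<lambda>x. F x \<bullet> b) \<in> weight_algebra \<kappa>" for F :: "'a \<Rightarrow> 'b"
  proof -
    have "\<forall>b\<in>Basis. \<exists>f'. (\<forall>x. ((\<lambda>x. F x \<bullet> b) has_derivative f' x) (at x)) \<and>
        (\<forall>v. (\<lambda>x. f' x v) \<in> weight_algebra \<kappa>)"
      using weight_algebra_derivative[OF F] by blast
    then obtain f' where f': "\<And>b x. b \<in> Basis \<Longrightarrow> ((\<lambda>x. F x \<bullet> b) has_derivative f' b x) (at x)"
      "\<And>b v. b \<in> Basis \<Longrightarrow> (\<lambda>x. f' b x v) \<in> weight_algebra \<kappa>"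
      by metis
    define F' where "F' x v = (\<Sum>b\<in>Basis. f' b x v *\<^sub>R b)" for x v
    have c: "F' x v \<bullet> b = f' b x v" if "b \<in> Basis" for x v b
      using that by (simp add: F'_def)
    have "(F has_derivative F' x) (at x)" for x
      unfolding has_derivative_componentwise_within[of F] using f'(1) by (simp add: c)
    then show ?thesis
      using f'(2) by (intro exI[of _ F']) (auto simp: c)
  qed
  {
    case 0
    obtain F' where "\<forall>x. (F has_derivative F' x) (at x)"
      using *[OF 0] by blast
    then have "isCont F x" for x
      using has_derivative_continuous by blast
    then have "continuous_on U F"
      by (simp add: continuous_at_imp_continuous_on)
    then show ?case
      by simp
  next
    case (Suc k)
    obtain F' where F': "\<forall>x. (F has_derivative F' x) (at x)"
      "\<forall>v. \<forall>b\<in>Basis. (\<lambda>x. F' x v \<bullet> b) \<in> weight_algebra \<kappa>"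
      using *[OF Suc.prems] by blast
    have "F differentiable_on U"
      using F'(1) by (meson differentiable_at_imp_differentiable_on differentiable_def)
    moreover have "frechet_derivative F (at x) = F' x" for x
      using F'(1) by (simp flip: frechet_derivative_at)
    ultimately show ?case
      using Suc.IH F'(2) by simp
  }
qed

section \<open>The Laplacian of radial maps\<close>

lemma weight_compose_has_derivative:
  assumes "(p has_real_derivative p') (at (weight \<kappa> x))"
  shows "((\<lambda>y. p (weight \<kappa> y)) has_derivative
    (\<lambda>v. - 2 * \<kappa>\<^sup>2 * (weight \<kappa> x)\<^sup>2 * p' * (x \<bullet> v))) (at x)"
  using has_derivative_compose[OF weight_has_derivative[of \<kappa> x]
      assms[unfolded has_field_derivative_def]]
  by (simp add: mult_ac)

text \<open>Rotationally equivariant maps into \<open>\<real>\<^sup>n \<times> \<real>\<close>. Their dependence on the norm is expressed through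
  the weight, because the inverse stereographic projection and its iterated Laplacians are polynomial in it.\<close>

definition radial :: "real \<Rightarrow> (real \<Rightarrow> real) \<Rightarrow> (real \<Rightarrow> real) \<Rightarrow> 'a::euclidean_space \<Rightarrow> 'a \<times> real" where
  "radial \<kappa> p r x = (p (weight \<kappa> x) *\<^sub>R x, r (weight \<kappa> x))"

lemma radial_has_derivative:
  assumes "(p has_real_derivative p') (at (weight \<kappa> x))" "(r has_real_derivative r') (at (weight \<kappa> x))"
  shows "(radial \<kappa> p r has_derivative
    (\<lambda>v. ((- 2 * \<kappa>\<^sup>2 * (weight \<kappa> x)\<^sup>2 * p' * (x \<bullet> v)) *\<^sub>R x + p (weight \<kappa> x) *\<^sub>R v,
      - 2 * \<kappa>\<^sup>2 * (weight \<kappa> x)\<^sup>2 * r' * (x \<bullet> v)))) (at x)"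
  unfolding radial_def[abs_def]
  by (auto intro!: derivative_eq_intros weight_compose_has_derivative assms simp: fun_eq_iff)

text \<open>Differentiating a function of \<open>u = weight \<kappa> x\<close> produces a factor \<open>x \<bullet> b\<close>. After summation over
  the basis only \<open>x \<bullet> x\<close> is left, and \<open>\<kappa>\<^sup>2 u (x \<bullet> x) = 1 - u\<close> turns this into a function of \<open>u\<close>
  again. The additional \<open>2\<close> in \<open>n + 2\<close> is the cross term between the coefficient \<open>p\<close> and the factor \<open>x\<close>.\<close>

lemma laplacian_radial:
  fixes x :: "'a::euclidean_space" and \<kappa> :: real
  assumes p: "\<And>u. (p has_real_derivative p' u) (at u)" "\<And>u. (p' has_real_derivative p'' u) (at u)"
    and r: "\<And>u. (r has_real_derivative r' u) (at u)" "\<And>u. (r' has_real_derivative r'' u) (at u)"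
  defines "n \<equiv> real DIM('a)" and "u \<equiv> weight \<kappa> x"
  shows "laplacian (radial \<kappa> p r) x =
    ((\<kappa>\<^sup>2 * u\<^sup>2 * (4 * (1 - u) * (2 * p' u + u * p'' u) - 2 * (n + 2) * p' u)) *\<^sub>R x,
     \<kappa>\<^sup>2 * u\<^sup>2 * (4 * (1 - u) * (2 * r' u + u * r'' u) - 2 * n * r' u))"
proof -
  define P where "P u = - 2 * \<kappa>\<^sup>2 * u\<^sup>2 * p' u" for u
  define R where "R u = - 2 * \<kappa>\<^sup>2 * u\<^sup>2 * r' u" for u
  define P' where "P' u = - 2 * \<kappa>\<^sup>2 * (2 * u * p' u + u\<^sup>2 * p'' u)" for u
  define R' where "R' u = - 2 * \<kappa>\<^sup>2 * (2 * u * r' u + u\<^sup>2 * r'' u)" for u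
  have P: "(P has_real_derivative P' u) (at u)" for u
    unfolding P_def[abs_def] P'_def by (auto intro!: derivative_eq_intros p simp: algebra_simps)
  have R: "(R has_real_derivative R' u) (at u)" for u
    unfolding R_def[abs_def] R'_def by (auto intro!: derivative_eq_intros r simp: algebra_simps)
  have first: "frechet_derivative (radial \<kappa> p r) (at y) b =
      ((P (weight \<kappa> y) * (y \<bullet> b)) *\<^sub>R y + p (weight \<kappa> y) *\<^sub>R b, R (weight \<kappa> y) * (y \<bullet> b))" for y b :: 'a
    using radial_has_derivative[OF p(1) r(1), of \<kappa> y]
    by (simp add: P_def R_def flip: frechet_derivative_at)
  define DP where "DP = - 2 * \<kappa>\<^sup>2 * u\<^sup>2 * P' u"
  define DR where "DR = - 2 * \<kappa>\<^sup>2 * u\<^sup>2 * R' u"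
  have dP: "((\<lambda>y. P (weight \<kappa> y)) has_derivative (\<lambda>v. DP * (x \<bullet> v))) (at x)"
    using weight_compose_has_derivative[OF P] unfolding DP_def u_def .
  have dR: "((\<lambda>y. R (weight \<kappa> y)) has_derivative (\<lambda>v. DR * (x \<bullet> v))) (at x)"
    using weight_compose_has_derivative[OF R] unfolding DR_def u_def .
  have dp: "((\<lambda>y. p (weight \<kappa> y)) has_derivative (\<lambda>v. P u * (x \<bullet> v))) (at x)"
    using weight_compose_has_derivative[OF p(1)] unfolding P_def u_def .
  have second: "frechet_derivative (\<lambda>y. frechet_derivative (radial \<kappa> p r) (at y) b) (at x) b =
      ((P u * (b \<bullet> b) + DP * ((x \<bullet> b) * (x \<bullet> b))) *\<^sub>R x + (2 * P u) *\<^sub>R ((x \<bullet> b) *\<^sub>R b),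
        R u * (b \<bullet> b) + DR * ((x \<bullet> b) * (x \<bullet> b)))" for b
  proof -
    have "((\<lambda>y. frechet_derivative (radial \<kappa> p r) (at y) b) has_derivative
        (\<lambda>v. ((P u * (x \<bullet> b)) *\<^sub>R v + (P u * (v \<bullet> b) + DP * (x \<bullet> v) * (x \<bullet> b)) *\<^sub>R x
            + (P u * (x \<bullet> v)) *\<^sub>R b,
          R u * (v \<bullet> b) + DR * (x \<bullet> v) * (x \<bullet> b)))) (at x)"
      unfolding first
      by (rule derivative_eq_intros dP dR dp refl)+ (simp add: fun_eq_iff u_def)
    moreover have "(2 * P u) *\<^sub>R ((x \<bullet> b) *\<^sub>R b) = (P u * (x \<bullet> b)) *\<^sub>R b + (P u * (x \<bullet> b)) *\<^sub>R b"
      by (simp flip: scaleR_left_distrib)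
    ultimately show ?thesis
      by (simp add: algebra_simps flip: frechet_derivative_at)
  qed
  have lin: "(\<Sum>b\<in>Basis. (2 * P u * (x \<bullet> b)) *\<^sub>R b) = (2 * P u) *\<^sub>R x"
    by (simp add: euclidean_representation flip: scaleR_scaleR scaleR_sum_right)
  have sq: "(\<Sum>b\<in>Basis. (x \<bullet> b) * (x \<bullet> b)) = x \<bullet> x"
    by (simp add: euclidean_inner[of x x])
  have "laplacian (radial \<kappa> p r) x =
      (\<Sum>b\<in>Basis. (P u + DP * ((x \<bullet> b) * (x \<bullet> b))) *\<^sub>R x + (2 * P u) *\<^sub>R ((x \<bullet> b) *\<^sub>R b),
       \<Sum>b\<in>(Basis::'a set). R u + DR * ((x \<bullet> b) * (x \<bullet> b)))"
    by (simp add: laplacian_def second sum_prod inner_Basis)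
  also have "\<dots> = ((n * P u + DP * (x \<bullet> x)) *\<^sub>R x + (2 * P u) *\<^sub>R x, n * R u + DR * (x \<bullet> x))"
    by (simp add: sum.distrib sum_distrib_left[symmetric] scaleR_sum_left[symmetric]
        lin sq n_def)
  also have "\<dots> = (((n + 2) * P u + DP * (x \<bullet> x)) *\<^sub>R x, n * R u + DR * (x \<bullet> x))"
    by (simp add: algebra_simps)
  finally have L: "laplacian (radial \<kappa> p r) x = \<dots>" .
  have xx: "\<kappa>\<^sup>2 * u * (x \<bullet> x) = 1 - u"
    using weight_denominator_pos[of \<kappa> x] by (simp add: u_def weight_def field_simps)
  have DP: "DP * (x \<bullet> x) = 4 * \<kappa>\<^sup>2 * u\<^sup>2 * (2 * p' u + u * p'' u) * (1 - u)"
    unfolding xx[symmetric] by (simp add: DP_def P'_def algebra_simps power2_eq_square)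
  have DR: "DR * (x \<bullet> x) = 4 * \<kappa>\<^sup>2 * u\<^sup>2 * (2 * r' u + u * r'' u) * (1 - u)"
    unfolding xx[symmetric] by (simp add: DR_def R'_def algebra_simps power2_eq_square)
  have "(n + 2) * P u + DP * (x \<bullet> x)
      = \<kappa>\<^sup>2 * u\<^sup>2 * (4 * (1 - u) * (2 * p' u + u * p'' u) - 2 * (n + 2) * p' u)"
    unfolding DP by (simp add: P_def algebra_simps)
  moreover have "n * R u + DR * (x \<bullet> x)
      = \<kappa>\<^sup>2 * u\<^sup>2 * (4 * (1 - u) * (2 * r' u + u * r'' u) - 2 * n * r' u)"
    unfolding DR by (simp add: R_def algebra_simps)
  ultimately show ?thesis
    unfolding L by simp
qed

section \<open>Integration by parts for compactly supported functions\<close>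

lemma integral_translation:
  fixes F :: "'a::euclidean_space \<Rightarrow> real"
  assumes [measurable]: "F \<in> borel_measurable borel"
  shows "(LINT x|lborel. F (x + a)) = (LINT x|lborel. F x)"
    and "integrable lborel F \<Longrightarrow> integrable lborel (\<lambda>x. F (x + a))"
proof -
  have "(LINT x|lborel. F x) = (LINT x|distr lborel borel ((+) a). F x)"
    by (simp add: lborel_distr_plus)
  also have "\<dots> = (LINT x|lborel. F (a + x))"
    by (rule integral_distr) auto
  finally show "(LINT x|lborel. F (x + a)) = (LINT x|lborel. F x)"
    by (simp add: add.commute)
  assume "integrable lborel F"
  then have "integrable (distr lborel borel ((+) a)) F"
    by (simp add: lborel_distr_plus)
  then have "integrable lborel (\<lambda>x. F (a + x))"
    by (subst (asm) integrable_distr_eq) auto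
  then show "integrable lborel (\<lambda>x. F (x + a))"
    by (simp add: add.commute)
qed

text \<open>By translation invariance every difference quotient \<open>(F(x + h b) - F(x)) / h\<close> has integral zero.
  By the mean value theorem the quotients are bounded and supported in one ball, so dominated
  convergence carries this over to the limit \<open>h \<rightarrow> 0\<close>.\<close>

lemma integral_directional_derivative_eq_0:
  fixes F :: "'a::euclidean_space \<Rightarrow> real"
  assumes U: "open U" and K: "compact K" "K \<subseteq> U"
    and F: "\<And>x. x \<in> U \<Longrightarrow> (F has_derivative F' x) (at x)"
    and cont: "continuous_on U (\<lambda>x. F' x b)"
    and supp: "\<And>x. x \<in> U - K \<Longrightarrow> F x = 0"
  shows "(LINT x:U|lborel. F' x b) = 0"
proof -
  \<comment> \<open>Extension by zero is differentiable everywhere, as \<open>U\<close> and the complement of \<open>K\<close> cover the space.\<close>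
  define G where "G x = (if x \<in> U then F x else 0)" for x
  define G' where "G' x = (if x \<in> U then F' x else (\<lambda>v. 0))" for x
  have openK: "open (- K)"
    using K compact_imp_closed by blast
  have zero: "(G has_derivative (\<lambda>v. 0)) (at x)" if "x \<notin> K" for x
    by (rule has_derivative_transform_within_open[OF has_derivative_const[of 0] openK])
      (use that supp in \<open>auto simp: G_def\<close>)
  have der: "(G has_derivative G' x) (at x)" for x
  proof (cases "x \<in> U")
    case True
    then show ?thesis
      using has_derivative_transform_within_open[OF F[OF True] U] by (auto simp: G_def G'_def)
  next
    case False
    then show ?thesis
      using zero[of x] K by (auto simp: G'_def)
  qed
  have G'0: "G' x = (\<lambda>v. 0)" if "x \<notin> K" for x
    using has_derivative_unique[OF der zero[OF that]] .
  have "continuous_on (U \<union> - K) (\<lambda>x. G' x b)"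
  proof (rule continuous_on_open_Un[OF U openK])
    show "continuous_on U (\<lambda>x. G' x b)"
      using cont by (subst continuous_on_cong[where g="\<lambda>x. F' x b"]) (auto simp: G'_def)
    show "continuous_on (- K) (\<lambda>x. G' x b)"
      by (subst continuous_on_cong[where g="\<lambda>x. 0"]) (auto simp: G'0)
  qed
  moreover have "U \<union> - K = UNIV"
    using K by auto
  ultimately have contG': "continuous_on UNIV (\<lambda>x. G' x b)"
    by simp
  have "isCont G x" for x
    using has_derivative_continuous[OF der] .
  then have contG: "continuous_on UNIV G"
    by (simp add: continuous_at_imp_continuous_on)
  obtain R where R: "\<And>x. x \<in> K \<Longrightarrow> norm x \<le> R"
    using compact_imp_bounded[OF K(1)] by (auto simp: bounded_iff)
  \<comment> \<open>The steps are at most 1, so all difference quotients vanish outside this ball.\<close>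
  define S where "S = cball (0::'a) (R + norm b)"
  have "bounded ((\<lambda>x. G' x b) ` K)"
    using contG' K by (intro compact_imp_bounded compact_continuous_image)
      (auto intro: continuous_on_subset)
  then obtain M where "\<And>x. x \<in> K \<Longrightarrow> \<bar>G' x b\<bar> \<le> M"
    by (auto simp: bounded_iff)
  then have M: "\<bar>G' x b\<bar> \<le> max M 0" for x
    using G'0[of x] by (cases "x \<in> K") fastforce+
  define e where "e n = 1 / real (Suc n)" for n
  have e: "0 < e n" "e n \<le> 1" for n
    by (auto simp: e_def)
  define Q where "Q n x = (G (x + e n *\<^sub>R b) - G x) / e n" for n x
  have Gout: "G x = 0" if "x \<notin> K" for x
    using that supp by (auto simp: G_def)
  have bound: "\<bar>Q n x\<bar> \<le> max M 0 * indicator S x" for n x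
  proof (cases "x \<in> S")
    case True
    have line: "((\<lambda>t. G (x + t *\<^sub>R b)) has_derivative (\<lambda>t. G' (x + s *\<^sub>R b) (t *\<^sub>R b))) (at s within {0..e n})"
      for s
      by (rule has_derivative_compose[OF _ der, of "\<lambda>t. x + t *\<^sub>R b"])
        (auto intro!: derivative_eq_intros)
    obtain s where s: "s \<in> {0<..<e n}" "G (x + e n *\<^sub>R b) - G (x + 0 *\<^sub>R b) = G' (x + s *\<^sub>R b) ((e n - 0) *\<^sub>R b)"
      using mvt_simple[OF e(1)[of n] line] by metis
    have "G' (x + s *\<^sub>R b) (e n *\<^sub>R b) = e n * G' (x + s *\<^sub>R b) b"
      using linear_scale[OF has_derivative_linear[OF der]] by simp
    then have "Q n x = G' (x + s *\<^sub>R b) b"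
      using s e(1)[of n] by (simp add: Q_def)
    then show ?thesis
      using M True by simp
  next
    case False
    have "norm (x + e n *\<^sub>R b) \<ge> norm x - norm (e n *\<^sub>R b)"
      by (metis add_diff_cancel_right' norm_triangle_ineq2 norm_minus_cancel diff_minus_eq_add)
    moreover have "norm (e n *\<^sub>R b) \<le> norm b"
      using e[of n] by (simp add: mult_left_le_one_le)
    ultimately have "norm (x + e n *\<^sub>R b) > R" "norm x > R"
      using False norm_ge_zero[of b] unfolding S_def mem_cball_0 by linarith+
    then have "x \<notin> K" "x + e n *\<^sub>R b \<notin> K"
      using R by force+
    then show ?thesis
      using False by (simp add: Q_def Gout)
  qed
  have lim: "(\<lambda>n. Q n x) \<longlonglongrightarrow> G' x b" for x
  proof -
    have "((\<lambda>t. G (x + t *\<^sub>R b)) has_derivative (\<lambda>t. G' (x + 0 *\<^sub>R b) (t *\<^sub>R b))) (at 0)"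
      by (rule has_derivative_compose[OF _ der, of "\<lambda>t. x + t *\<^sub>R b"])
        (auto intro!: derivative_eq_intros)
    moreover have "G' x (t *\<^sub>R b) = G' x b * t" for t
      using linear_scale[OF has_derivative_linear[OF der]] by simp
    ultimately have "((\<lambda>t. G (x + t *\<^sub>R b)) has_real_derivative G' x b) (at 0)"
      by (simp add: has_field_derivative_def)
    then have "((\<lambda>t. (G (x + t *\<^sub>R b) - G x) / t) \<longlongrightarrow> G' x b) (at 0)"
      by (simp add: has_field_derivative_iff)
    moreover have "filterlim e (at 0) sequentially"
      unfolding filterlim_at e_def using e lim_1_over_n LIMSEQ_Suc[OF lim_1_over_n] by (auto simp: e_def)
    ultimately show ?thesis
      unfolding Q_def by (rule filterlim_compose)
  qed
  have meas: "G \<in> borel_measurable lborel" "(\<lambda>x. G' x b) \<in> borel_measurable lborel"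
    using contG contG' by (auto intro: borel_measurable_continuous_onI)
  have intG: "integrable lborel G"
  proof -
    have "integrable lborel (\<lambda>x. indicator K x *\<^sub>R G x)"
      using borel_integrable_compact[OF K(1)] contG continuous_on_subset
      by (metis subset_UNIV)
    moreover have "(\<lambda>x. indicator K x *\<^sub>R G x) = G"
      using Gout by (auto simp: fun_eq_iff indicator_def)
    ultimately show ?thesis by simp
  qed
  have "(\<lambda>n. LINT x|lborel. Q n x) \<longlonglongrightarrow> (LINT x|lborel. G' x b)"
  proof (rule integral_dominated_convergence[where w="\<lambda>x. max M 0 * indicator S x"])
    show "integrable lborel (\<lambda>x. max M 0 * indicator S x)"
      unfolding S_def using emeasure_lborel_cball_finite[of 0 "R + norm b"] by (intro integrable_mult_right) (auto simp: top.not_eq_extremum)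
    show "Q n \<in> borel_measurable lborel" for n
      unfolding Q_def using meas(1) by measurable
  qed (use meas bound lim in auto)
  moreover have "(LINT x|lborel. Q n x) = 0" for n
  proof -
    have "integrable lborel (\<lambda>x. G (x + e n *\<^sub>R b))"
      "(LINT x|lborel. G (x + e n *\<^sub>R b)) = (LINT x|lborel. G x)"
      using integral_translation[of G] meas(1) intG by auto
    then show ?thesis
      using intG unfolding Q_def by simp
  qed
  ultimately have "(LINT x|lborel. G' x b) = 0"
    by (simp add: LIMSEQ_const_iff)
  moreover have "indicator U x *\<^sub>R F' x b = G' x b" for x
    by (simp add: G'_def)
  ultimately show ?thesis
    by (simp add: set_lebesgue_integral_def)
qed

lemma set_integrable_compact_support:
  fixes f :: "'a::euclidean_space \<Rightarrow> real"
  assumes "compact K" "K \<subseteq> U" "continuous_on U f" "\<And>x. x \<in> U - K \<Longrightarrow> f x = 0"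
  shows "set_integrable lborel U f"
proof -
  have "set_integrable lborel K f"
    using borel_integrable_compact[OF assms(1)] continuous_on_subset[OF assms(3,2)]
    unfolding set_integrable_def by blast
  moreover have "(\<lambda>x. indicator U x *\<^sub>R f x) = (\<lambda>x. indicator K x *\<^sub>R f x)"
    using assms(2,4) by (auto simp: fun_eq_iff indicator_def)
  ultimately show ?thesis
    unfolding set_integrable_def by simp
qed

text \<open>For each basis vector, \<open>\<langle>f, \<partial>\<partial>W\<rangle> - \<langle>\<partial>\<partial>f, W\<rangle>\<close> is the derivative of the compactly supported function
  \<open>\<langle>f, \<partial>W\<rangle> - \<langle>\<partial>f, W\<rangle>\<close>, so its integral vanishes.\<close>

lemma green_identity:
  fixes f W :: "'a::euclidean_space \<Rightarrow> 'b::euclidean_space"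
  assumes U: "open U" and K: "compact K" "K \<subseteq> U"
    and f: "Ck_on 2 U f" and W: "Ck_on 2 U W" and supp: "\<And>x. x \<in> U - K \<Longrightarrow> W x = 0"
  shows "(LINT x:U|lborel. f x \<bullet> laplacian W x) = (LINT x:U|lborel. laplacian f x \<bullet> W x)"
proof -
  define p where "p g b x = frechet_derivative g (at x) b" for g :: "'a \<Rightarrow> 'b" and b x
  note Ck = f W
  have d1: "(g has_derivative (\<lambda>v. p g v x)) (at x)" if "x \<in> U" "Ck_on 2 U g" for g x
    using Ck_on_differentiable_at[OF U _ that(1), of 1 g] that(2) by (simp add: numeral_2_eq_2 p_def)
  have C1: "Ck_on 1 U (p g b)" if "Ck_on 2 U g" for g b
    using that by (simp add: numeral_2_eq_2 p_def[abs_def])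
  have d2: "(p g b has_derivative (\<lambda>v. p (p g b) v x)) (at x)" if "x \<in> U" "Ck_on 2 U g" for g b x
    using Ck_on_differentiable_at[OF U _ that(1), of 0 "p g b"] C1[OF that(2), of b] by (simp add: p_def)
  have cont: "continuous_on U g" "continuous_on U (p g b)" "continuous_on U (p (p g b) b)"
    if "Ck_on 2 U g" for g b
    using Ck_on_imp_continuous_on[OF that] Ck_on_imp_continuous_on[OF C1[OF that]] C1[OF that, of b]
    by (auto simp: p_def[abs_def])
  have openUK: "open (U - K)"
    using U K by (simp add: compact_imp_closed open_Diff)
  have W1: "p W b x = 0" if "x \<in> U - K" for b x
    using frechet_derivative_cong_open[OF openUK that, of W "\<lambda>x. 0"] supp by (simp add: p_def)
  have W2: "p (p W b) b x = 0" if "x \<in> U - K" for b x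
    using frechet_derivative_cong_open[OF openUK that, of "p W b" "\<lambda>x. 0"] W1
    unfolding p_def[of "p W b"] by simp
  define F where "F b x = f x \<bullet> p W b x - p f b x \<bullet> W x" for b x
  have zero: "(LINT x:U|lborel. f x \<bullet> p (p W b) b x - p (p f b) b x \<bullet> W x) = 0" for b
  proof (rule integral_directional_derivative_eq_0[OF U K,
        where F="F b" and F'="\<lambda>x v. f x \<bullet> p (p W b) v x + p f v x \<bullet> p W b x
          - (p f b x \<bullet> p W v x + p (p f b) v x \<bullet> W x)" and b=b, simplified])
    show "(F b has_derivative (\<lambda>v. f x \<bullet> p (p W b) v x + p f v x \<bullet> p W b x
          - (p f b x \<bullet> p W v x + p (p f b) v x \<bullet> W x))) (at x)" if "x \<in> U" for x
      unfolding F_def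
      by (intro has_derivative_diff has_derivative_inner d1 d2 that Ck)
    show "continuous_on U (\<lambda>x. f x \<bullet> p (p W b) b x - p (p f b) b x \<bullet> W x)"
      by (intro continuous_intros cont Ck)
    show "F b x = 0" if "x \<in> U \<and> x \<notin> K" for x
      using that W1 supp by (simp add: F_def)
  qed
  have int: "set_integrable lborel U (\<lambda>x. f x \<bullet> p (p W b) b x)"
    "set_integrable lborel U (\<lambda>x. p (p f b) b x \<bullet> W x)" for b
    by (rule set_integrable_compact_support[OF K], intro continuous_intros cont Ck, simp add: W2 supp)+
  have by_parts: "(LINT x:U|lborel. f x \<bullet> p (p W b) b x) = (LINT x:U|lborel. p (p f b) b x \<bullet> W x)" for b
    using zero[of b] int[of b] by simp
  have lap: "laplacian g x = (\<Sum>b\<in>Basis. p (p g b) b x)" for g x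
    by (simp add: laplacian_def p_def[abs_def])
  have "(LINT x:U|lborel. f x \<bullet> laplacian W x) = (\<Sum>b\<in>Basis. LINT x:U|lborel. f x \<bullet> p (p W b) b x)"
    unfolding set_lebesgue_integral_def lap inner_sum_right scaleR_sum_right
    by (rule Bochner_Integration.integral_sum) (rule int(1)[unfolded set_integrable_def])
  also have "\<dots> = (\<Sum>b\<in>Basis. LINT x:U|lborel. p (p f b) b x \<bullet> W x)"
    by (simp only: by_parts)
  also have "\<dots> = (LINT x:U|lborel. laplacian f x \<bullet> W x)"
    unfolding set_lebesgue_integral_def lap inner_sum_left scaleR_sum_right
    by (rule Bochner_Integration.integral_sum[symmetric]) (rule int(2)[unfolded set_integrable_def])
  finally show ?thesis .
qed

section \<open>The first variation of the bienergy\<close>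

lemma quadratic_increment_imp_derivative_0:
  fixes E :: "real \<Rightarrow> real"
  assumes "r > 0" "\<And>s. \<bar>s\<bar> < r \<Longrightarrow> \<bar>E s - E 0\<bar> \<le> C * s\<^sup>2"
  shows "(E has_real_derivative 0) (at 0)"
proof -
  have "((\<lambda>s. (E s - E 0) / (s - 0)) \<longlongrightarrow> 0) (at 0)"
  proof (rule Lim_null_comparison)
    show "((\<lambda>s. C * \<bar>s\<bar>) \<longlongrightarrow> 0) (at 0)"
      by (auto intro!: tendsto_eq_intros)
    have "eventually (\<lambda>s. \<bar>s\<bar> < r) (at 0)"
      using assms(1) eventually_at[of _ "0::real" UNIV] by (auto simp: dist_real_def)
    moreover have "eventually (\<lambda>s::real. s \<noteq> 0) (at 0)"
      by (simp add: eventually_at_filter)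
    ultimately show "eventually (\<lambda>s. norm ((E s - E 0) / (s - 0)) \<le> C * \<bar>s\<bar>) (at 0)"
    proof eventually_elim
      case (elim s)
      then show ?case
        using assms(2)[of s] by (simp add: abs_divide pos_divide_le_eq power2_eq_square mult.assoc)
    qed
  qed
  then show ?thesis
    by (simp add: has_field_derivative_iff)
qed

text \<open>Applied to the variation and to its second derivatives in \<open>x\<close>, this makes the increments of the
  variation and of its Laplacian \<open>O(s)\<close> uniformly on compact sets, without exchanging derivatives in \<open>s\<close> and \<open>x\<close>.\<close>

lemma slice_increment_bound:
  fixes H :: "real \<times> 'a::euclidean_space \<Rightarrow> 'b::euclidean_space"
  assumes W: "open W" and H: "Ck_on (Suc 0) W H" and K: "compact K" and sub: "{-r..r} \<times> K \<subseteq> W"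
  obtains B where "B \<ge> 0" "\<And>s x. \<bar>s\<bar> \<le> r \<Longrightarrow> x \<in> K \<Longrightarrow> norm (H (s, x) - H (0, x)) \<le> B * \<bar>s\<bar>"
proof -
  define D where "D z = frechet_derivative H (at z) (1, 0)" for z
  have "continuous_on ({-r..r} \<times> K) D"
    unfolding D_def by (rule continuous_on_subset[OF _ sub]) (use H in simp)
  then have "bounded (D ` ({-r..r} \<times> K))"
    using K by (intro compact_imp_bounded compact_continuous_image compact_Times) auto
  then obtain B where B: "B > 0" "\<And>z. z \<in> {-r..r} \<times> K \<Longrightarrow> norm (D z) \<le> B"
    by (auto simp: bounded_pos)
  show thesis
  proof
    show "B \<ge> 0"
      using B by simp
    fix s :: real and x
    assume s: "\<bar>s\<bar> \<le> r" and x: "x \<in> K"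
    have der: "((\<lambda>t. H (t, x)) has_derivative (\<lambda>u. u *\<^sub>R D (t, x))) (at t within {-r..r})"
      if "t \<in> {-r..r}" for t
    proof -
      have "(t, x) \<in> W"
        using that x sub by auto
      then have dH: "(H has_derivative frechet_derivative H (at (t, x))) (at (t, x))"
        by (rule Ck_on_differentiable_at[OF W H])
      have "((\<lambda>t. (t, x)) has_derivative (\<lambda>u. (u, 0))) (at t within {-r..r})"
        by (auto intro!: derivative_eq_intros)
      then have "((\<lambda>t. H (t, x)) has_derivative (\<lambda>u. frechet_derivative H (at (t, x)) (u, 0))) (at t within {-r..r})"
        by (rule has_derivative_compose) (use dH in simp)
      moreover have "frechet_derivative H (at (t, x)) (u, 0) = u *\<^sub>R D (t, x)" for u
        using linear_scale[OF has_derivative_linear[OF dH], of u "(1, 0)"] by (simp add: D_def)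
      ultimately show ?thesis
        by simp
    qed
    have "norm (H (s, x) - H (0, x)) \<le> B * norm (s - 0)"
    proof (rule differentiable_bound[OF _ der])
      show "onorm (\<lambda>u. u *\<^sub>R D (t, x)) \<le> B" if "t \<in> {-r..r}" for t
        using B(2)[of "(t, x)"] that x by (intro onorm_le) (simp add: mult.commute[of B] mult_left_mono)
    qed (use s in auto)
    then show "norm (H (s, x) - H (0, x)) \<le> B * \<bar>s\<bar>"
      by simp
  qed
qed

lemma laplacian_slice:
  fixes G :: "real \<times> 'a::euclidean_space \<Rightarrow> 'b::euclidean_space"
  assumes W: "open W" and U: "open U" and G: "Ck_on (Suc (Suc 0)) W G" and sub: "{s} \<times> U \<subseteq> W" and x: "x \<in> U"
  shows "laplacian (\<lambda>y. G (s, y)) x =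
    (\<Sum>b\<in>Basis. frechet_derivative (\<lambda>z. frechet_derivative G (at z) (0, b)) (at (s, x)) (0, b))"
proof -
  have slice: "frechet_derivative (\<lambda>y. H (s, y)) (at y) b = frechet_derivative H (at (s, y)) (0, b)"
    if "Ck_on (Suc k) W H" "y \<in> U" for H :: "real \<times> 'a \<Rightarrow> 'b" and k y b
    using slice_has_derivative[OF Ck_on_differentiable_at[OF W that(1)], of s y] sub that(2)
    by (auto simp flip: frechet_derivative_at)
  have "frechet_derivative (\<lambda>y. frechet_derivative (\<lambda>y. G (s, y)) (at y) b) (at x) b
      = frechet_derivative (\<lambda>z. frechet_derivative G (at z) (0, b)) (at (s, x)) (0, b)" for b
    using frechet_derivative_cong_open[OF U x slice[OF G]]
      slice[of 0 "\<lambda>z. frechet_derivative G (at z) (0, b)" x b] G x by simp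
  then show ?thesis
    by (simp add: laplacian_def)
qed

lemma norm_tangent_proj_squared:
  assumes "d > 0" "norm P = 1 / d"
  shows "(norm (tangent_proj d P L))\<^sup>2 = (norm L)\<^sup>2 - d\<^sup>2 * (L \<bullet> P)\<^sup>2"
proof -
  have PP: "d\<^sup>2 * (P \<bullet> P) = 1"
    using assms by (simp add: dot_square_norm power_divide)
  have "(norm (tangent_proj d P L))\<^sup>2 = L \<bullet> L - 2 * d\<^sup>2 * (L \<bullet> P)\<^sup>2 + d\<^sup>2 * (L \<bullet> P)\<^sup>2 * (d\<^sup>2 * (P \<bullet> P))"
    unfolding power2_norm_eq_inner tangent_proj_def
    by (simp add: inner_diff inner_commute power2_eq_square algebra_simps)
  then show ?thesis
    unfolding PP by (simp add: power2_norm_eq_inner)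
qed

text \<open>Here \<open>P\<close> and \<open>L\<close> stand for the values of \<open>\<phi>\<close> and \<open>\<Delta>\<phi>\<close> at a point, and \<open>Q\<close> and \<open>M\<close> for those of a
  nearby map. With \<open>X = Q - P\<close>, \<open>N = M - L\<close> and \<open>e = \<langle>M, Q\<rangle> - \<langle>L, P\<rangle>\<close>, subtracting from the increment of the
  density its part linear in \<open>(X, N)\<close> leaves exactly
  \<open>|N|\<^sup>2 / 2 - d\<^sup>2 \<langle>L, P\<rangle> \<langle>N, X\<rangle> - d\<^sup>2 e\<^sup>2 / 2\<close>, in which every term is quadratic in the increments.\<close>

lemma bienergy_density_remainder:
  fixes P Q L M :: "'b::euclidean_space"
  assumes d: "d > 0" and P: "norm P = 1 / d" and Q: "norm Q = 1 / d" and m: "norm L \<le> m"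
    and QP: "norm (Q - P) \<le> B * s" and LM: "norm (M - L) \<le> B * s" and s: "0 \<le> s" "s \<le> 1" and B: "0 \<le> B"
  shows "\<bar>1/2 * (norm (tangent_proj d Q M))\<^sup>2 - 1/2 * (norm (tangent_proj d P L))\<^sup>2
      - tangent_proj d P L \<bullet> (M - L) + d\<^sup>2 * (L \<bullet> P) * (L \<bullet> (Q - P))\<bar>
    \<le> (B\<^sup>2 / 2 + d * m * B\<^sup>2 + d\<^sup>2 / 2 * (B / d + m * B + B\<^sup>2)\<^sup>2) * s\<^sup>2"
proof -
  define X where "X = Q - P"
  define N where "N = M - L"
  define e where "e = N \<bullet> P + L \<bullet> X + N \<bullet> X"
  have m0: "0 \<le> m"
    using m norm_ge_zero order_trans by blast
  have Bs: "0 \<le> B * s"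
    using B s by simp
  have expand: "1/2 * (norm (tangent_proj d Q M))\<^sup>2 - 1/2 * (norm (tangent_proj d P L))\<^sup>2
      - tangent_proj d P L \<bullet> N + d\<^sup>2 * (L \<bullet> P) * (L \<bullet> X)
      = 1/2 * (norm N)\<^sup>2 - d\<^sup>2 * (L \<bullet> P) * (N \<bullet> X) - d\<^sup>2 / 2 * e\<^sup>2"
  proof -
    have "M = L + N" "Q = P + X"
      by (simp_all add: N_def X_def)
    then have MQ: "M \<bullet> Q = L \<bullet> P + e" and MM: "(norm M)\<^sup>2 = (norm L)\<^sup>2 + 2 * (L \<bullet> N) + (norm N)\<^sup>2"
      unfolding e_def power2_norm_eq_inner by (simp_all add: inner_add inner_commute)
    have TN: "tangent_proj d P L \<bullet> N = L \<bullet> N - d\<^sup>2 * (L \<bullet> P) * (N \<bullet> P)"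
      by (simp add: tangent_proj_def inner_diff_left inner_commute[of P N])
    show ?thesis
      unfolding norm_tangent_proj_squared[OF d P] norm_tangent_proj_squared[OF d Q] MQ MM TN
      by (simp add: e_def power2_eq_square field_simps)
  qed
  have "(norm N)\<^sup>2 \<le> B\<^sup>2 * s\<^sup>2"
    using power_mono[OF LM norm_ge_zero, of 2] by (simp add: N_def power_mult_distrib)
  moreover have "\<bar>d\<^sup>2 * (L \<bullet> P) * (N \<bullet> X)\<bar> \<le> d * m * B\<^sup>2 * s\<^sup>2"
  proof -
    have "\<bar>L \<bullet> P\<bar> \<le> m * (1 / d)"
      using Cauchy_Schwarz_ineq2[of L P] m P d mult_right_mono[of "norm L" m "1 / d"] by simp
    moreover have "\<bar>N \<bullet> X\<bar> \<le> (B * s) * (B * s)"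
      using Cauchy_Schwarz_ineq2[of N X] mult_mono[OF LM QP Bs] by (simp add: N_def X_def)
    ultimately have "\<bar>L \<bullet> P\<bar> * \<bar>N \<bullet> X\<bar> \<le> (m * (1 / d)) * ((B * s) * (B * s))"
      using m0 d by (intro mult_mono) auto
    then have "d\<^sup>2 * (\<bar>L \<bullet> P\<bar> * \<bar>N \<bullet> X\<bar>) \<le> d\<^sup>2 * ((m * (1 / d)) * ((B * s) * (B * s)))"
      by (rule mult_left_mono) simp
    then show ?thesis
      using d by (simp add: abs_mult power2_eq_square mult_ac)
  qed
  moreover have "d\<^sup>2 / 2 * e\<^sup>2 \<le> d\<^sup>2 / 2 * (B / d + m * B + B\<^sup>2)\<^sup>2 * s\<^sup>2"
  proof -
    have "\<bar>N \<bullet> P\<bar> \<le> (B * s) * (1 / d)"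
      using Cauchy_Schwarz_ineq2[of N P] LM P d mult_right_mono[of "norm N" "B * s" "1 / d"]
      by (simp add: N_def)
    moreover have "\<bar>L \<bullet> X\<bar> \<le> m * (B * s)"
      using Cauchy_Schwarz_ineq2[of L X] mult_mono[OF m QP m0] by (simp add: X_def)
    moreover have "\<bar>N \<bullet> X\<bar> \<le> (B * s) * B"
    proof -
      have "B * s \<le> B"
        using B s by (simp add: mult_left_le)
      then have "norm X \<le> B"
        using QP by (simp add: X_def)
      then show ?thesis
        using Cauchy_Schwarz_ineq2[of N X] mult_mono[OF LM _ Bs, of "norm X" B] by (simp add: N_def)
    qed
    ultimately have "\<bar>e\<bar> \<le> (B / d + m * B + B\<^sup>2) * s"
      unfolding e_def by (simp add: algebra_simps power2_eq_square)
    then have "\<bar>e\<bar>\<^sup>2 \<le> ((B / d + m * B + B\<^sup>2) * s)\<^sup>2"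
      by (intro power_mono) auto
    then have "e\<^sup>2 \<le> (B / d + m * B + B\<^sup>2)\<^sup>2 * s\<^sup>2"
      by (simp add: power_mult_distrib)
    then show ?thesis
      using mult_left_mono[of "e\<^sup>2" _ "d\<^sup>2 / 2"] by (simp add: mult.assoc)
  qed
  moreover have "0 \<le> d\<^sup>2 / 2 * e\<^sup>2" "0 \<le> (norm N)\<^sup>2"
    by auto
  ultimately have "\<bar>1/2 * (norm N)\<^sup>2 - d\<^sup>2 * (L \<bullet> P) * (N \<bullet> X) - d\<^sup>2 / 2 * e\<^sup>2\<bar>
      \<le> B\<^sup>2 * s\<^sup>2 / 2 + d * m * B\<^sup>2 * s\<^sup>2 + d\<^sup>2 / 2 * (B / d + m * B + B\<^sup>2)\<^sup>2 * s\<^sup>2"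
    by linarith
  then show ?thesis
    unfolding N_def[symmetric] X_def[symmetric] expand by (simp only: distrib_right times_divide_eq_left)
qed

text \<open>The equation in the hypothesis is the biharmonic equation: on the sphere of radius \<open>1 / d\<close> one has
  \<open>\<langle>\<Delta>\<phi>, \<phi>\<rangle> = - |d\<phi>|\<^sup>2\<close>, so it equates the tangential part of \<open>\<Delta>\<tau>\<close> with \<open>- d\<^sup>2 |d\<phi>|\<^sup>2 \<tau>\<close>. Together with
  Green's identity it removes the part of the increment of the bienergy that is linear in \<open>\<Phi>\<^sub>s - \<phi>\<close>, up to a
  quadratic error, so that the bienergy changes by \<open>O(s\<^sup>2)\<close>.\<close>

lemma first_variation_eq_0:
  fixes \<phi> :: "'a::euclidean_space \<Rightarrow> 'b::euclidean_space"
  assumes U: "open U" and d: "d > 0" and phi: "Ck_on 2 U \<phi>" and tau: "Ck_on 2 U (tension d \<phi>)"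
    and energy: "set_integrable lborel U (\<lambda>x. (norm (tension d \<phi> x))\<^sup>2)"
    and biharmonic: "\<And>x. x \<in> U \<Longrightarrow> tangent_proj d (\<phi> x) (laplacian (tension d \<phi>) x)
      = (d\<^sup>2 * (laplacian \<phi> x \<bullet> \<phi> x)) *\<^sub>R tension d \<phi> x"
    and var: "variation d U \<phi> \<Phi> \<epsilon>"
  shows "((\<lambda>s. bienergy d U (\<Phi> s)) has_real_derivative 0) (at 0)"
proof -
  define \<tau> where "\<tau> = tension d \<phi>"
  define L where "L = laplacian \<phi>"
  obtain W G where W: "open W" "{-\<epsilon><..<\<epsilon>} \<times> U \<subseteq> W" and G: "\<And>k. Ck_on k W G"
    and G\<Phi>: "\<And>s x. s \<in> {-\<epsilon><..<\<epsilon>} \<Longrightarrow> x \<in> U \<Longrightarrow> G (s, x) = \<Phi> s x"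
    using var unfolding variation_def smooth_on_def by fastforce
  obtain K where K: "compact K" "K \<subseteq> U"
    and fixed: "\<And>s x. s \<in> {-\<epsilon><..<\<epsilon>} \<Longrightarrow> x \<in> U - K \<Longrightarrow> \<Phi> s x = \<phi> x"
    using var unfolding variation_def by blast
  have eps: "\<epsilon> > 0" and \<Phi>0: "\<And>x. x \<in> U \<Longrightarrow> \<Phi> 0 x = \<phi> x"
    and sphere: "\<And>s x. s \<in> {-\<epsilon><..<\<epsilon>} \<Longrightarrow> x \<in> U \<Longrightarrow> norm (\<Phi> s x) = 1 / d"
    using var unfolding variation_def by auto
  have C2\<Phi>: "Ck_on 2 U (\<Phi> s)" if "s \<in> {-\<epsilon><..<\<epsilon>}" for s
    using Ck_on_cong[OF U Ck_on_slice[OF W(1) U G]] W(2) G\<Phi> that by blast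
  have sphere0: "norm (\<phi> x) = 1 / d" if "x \<in> U" for x
    using sphere[of 0 x] \<Phi>0[OF that] that eps by simp
  have openUK: "open (U - K)"
    using U K by (simp add: compact_imp_closed open_Diff)
  have cont: "continuous_on U f" "continuous_on U (laplacian f)"
    if "Ck_on 2 U f" for f :: "'a \<Rightarrow> 'b"
    using Ck_on_imp_continuous_on[OF that] Ck_on_laplacian_continuous[of 0 U f] that
    by (auto simp: numeral_2_eq_2)

  define r where "r = min (\<epsilon> / 2) 1"
  have r: "0 < r" "r < \<epsilon>" "r \<le> 1"
    using eps by (auto simp: r_def)
  have box: "{-r..r} \<times> K \<subseteq> W"
    using W(2) K(2) r by fastforce
  define H where "H b z = frechet_derivative (\<lambda>z. frechet_derivative G (at z) (0, b)) (at z) (0, b)" for b z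
  have lapH: "laplacian (\<Phi> s) x = (\<Sum>b\<in>Basis. H b (s, x))" if "s \<in> {-\<epsilon><..<\<epsilon>}" "x \<in> U" for s x
  proof -
    have "laplacian (\<Phi> s) x = laplacian (\<lambda>y. G (s, y)) x"
      using G\<Phi> that by (intro laplacian_cong_open[OF U]) auto
    moreover have "{s} \<times> U \<subseteq> W"
      using W(2) that by auto
    ultimately show ?thesis
      using laplacian_slice[OF W(1) U G _ that(2)] by (simp add: H_def)
  qed
  obtain B1 where B1: "B1 \<ge> 0" "\<And>s x. \<bar>s\<bar> \<le> r \<Longrightarrow> x \<in> K \<Longrightarrow> norm (G (s, x) - G (0, x)) \<le> B1 * \<bar>s\<bar>"
    using slice_increment_bound[OF W(1) G K(1) box] by metis
  have "\<exists>B. B \<ge> 0 \<and> (\<forall>s x. \<bar>s\<bar> \<le> r \<longrightarrow> x \<in> K \<longrightarrow> norm (H b (s, x) - H b (0, x)) \<le> B * \<bar>s\<bar>)" for b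
  proof -
    have "Ck_on (Suc 0) W (H b)"
      using G[of "Suc (Suc (Suc 0))"] unfolding H_def by simp
    from slice_increment_bound[OF W(1) this K(1) box] show ?thesis
      by metis
  qed
  then obtain B2 where B2: "\<And>b. B2 b \<ge> 0"
    "\<And>b s x. \<bar>s\<bar> \<le> r \<Longrightarrow> x \<in> K \<Longrightarrow> norm (H b (s, x) - H b (0, x)) \<le> B2 b * \<bar>s\<bar>"
    by metis
  define B where "B = B1 + (\<Sum>b\<in>(Basis::'a set). B2 b)"
  have sumB2: "0 \<le> (\<Sum>b\<in>(Basis::'a set). B2 b)"
    using B2(1) by (simp add: sum_nonneg)
  have B0: "0 \<le> B"
    using B1 sumB2 by (simp add: B_def)
  have s0: "0 \<in> {-\<epsilon><..<\<epsilon>}"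
    using eps by simp
  have L0: "L x = laplacian (\<Phi> 0) x" if "x \<in> U" for x
    unfolding L_def using \<Phi>0 by (intro laplacian_cong_open[OF U that]) auto
  have incr: "norm (\<Phi> s x - \<phi> x) \<le> B * \<bar>s\<bar>" "norm (laplacian (\<Phi> s) x - L x) \<le> B * \<bar>s\<bar>"
    if s: "\<bar>s\<bar> \<le> r" and x: "x \<in> K" for s x
  proof -
    have s': "s \<in> {-\<epsilon><..<\<epsilon>}" and x': "x \<in> U"
      using s r x K by auto
    have "norm (\<Phi> s x - \<phi> x) \<le> B1 * \<bar>s\<bar>"
      using B1(2)[OF s x] G\<Phi>[OF s' x'] G\<Phi>[OF s0 x'] \<Phi>0[OF x'] by simp
    also have "\<dots> \<le> B * \<bar>s\<bar>"
      using sumB2 by (intro mult_right_mono) (auto simp: B_def)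
    finally show "norm (\<Phi> s x - \<phi> x) \<le> B * \<bar>s\<bar>" .
    have "norm (laplacian (\<Phi> s) x - L x) = norm (\<Sum>b\<in>Basis. H b (s, x) - H b (0, x))"
      using lapH[OF s' x'] lapH[OF s0 x'] L0[OF x'] by (simp add: sum_subtractf)
    also have "\<dots> \<le> (\<Sum>b\<in>(Basis::'a set). B2 b * \<bar>s\<bar>)"
      using B2(2)[OF s x] by (intro sum_norm_le) auto
    also have "\<dots> = (\<Sum>b\<in>(Basis::'a set). B2 b) * \<bar>s\<bar>"
      by (simp add: sum_distrib_right)
    also have "\<dots> \<le> B * \<bar>s\<bar>"
      using B1(1) by (intro mult_right_mono) (auto simp: B_def)
    finally show "norm (laplacian (\<Phi> s) x - L x) \<le> B * \<bar>s\<bar>" .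
  qed

  \<comment> \<open>In \<open>\<Delta>\<tau> - d\<^sup>2 \<langle>\<Delta>\<phi>, \<phi>\<rangle> \<Delta>\<phi>\<close> the tangential parts cancel; \<open>\<mu>\<close> is the coefficient of what is left along \<open>\<phi>\<close>.\<close>
  define \<mu> where "\<mu> x = d\<^sup>2 * (laplacian \<tau> x \<bullet> \<phi> x) - d\<^sup>2 * d\<^sup>2 * (L x \<bullet> \<phi> x)\<^sup>2" for x
  have cont\<mu>: "continuous_on U \<mu>"
    unfolding \<mu>_def L_def \<tau>_def by (intro continuous_intros cont phi tau)
  have contL: "continuous_on U L"
    unfolding L_def by (intro cont phi)
  have "bounded (L ` K)" "bounded (\<mu> ` K)"
    using contL cont\<mu> K by (auto intro!: compact_imp_bounded compact_continuous_image
        intro: continuous_on_subset)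
  then obtain m l where m: "\<And>x. x \<in> K \<Longrightarrow> norm (L x) \<le> m" and l: "\<And>x. x \<in> K \<Longrightarrow> \<bar>\<mu> x\<bar> \<le> l"
    unfolding bounded_iff by auto
  have normal: "laplacian \<tau> x - (d\<^sup>2 * (L x \<bullet> \<phi> x)) *\<^sub>R L x = \<mu> x *\<^sub>R \<phi> x" if "x \<in> U" for x
  proof -
    have "laplacian \<tau> x = (d\<^sup>2 * (L x \<bullet> \<phi> x)) *\<^sub>R \<tau> x + (d\<^sup>2 * (laplacian \<tau> x \<bullet> \<phi> x)) *\<^sub>R \<phi> x"
      using biharmonic[OF that] by (simp add: tangent_proj_def \<tau>_def L_def algebra_simps)
    moreover have "\<tau> x = L x - (d\<^sup>2 * (L x \<bullet> \<phi> x)) *\<^sub>R \<phi> x"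
      by (simp add: \<tau>_def tension_eq tangent_proj_def L_def)
    ultimately show ?thesis
      by (simp add: \<mu>_def algebra_simps power2_eq_square)
  qed

  define C where "C = B\<^sup>2 / 2 + d * m * B\<^sup>2 + d\<^sup>2 / 2 * (B / d + m * B + B\<^sup>2)\<^sup>2 + l * B\<^sup>2 / 2"
  have "\<bar>bienergy d U (\<Phi> s) - bienergy d U (\<Phi> 0)\<bar> \<le> C * measure lborel K * s\<^sup>2" if "\<bar>s\<bar> < r" for s
  proof -
    have s: "s \<in> {-\<epsilon><..<\<epsilon>}"
      using that r by auto
    define X where "X x = \<Phi> s x - \<phi> x" for x
    define N where "N = laplacian X"
    have C2X: "Ck_on 2 U X"
      unfolding X_def using C2\<Phi>[OF s] phi by (intro Ck_on_diff[OF U])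
    have N: "N x = laplacian (\<Phi> s) x - L x" if "x \<in> U" for x
      unfolding N_def X_def L_def
      using laplacian_diff[OF U that] C2\<Phi>[OF s] phi by (metis numeral_2_eq_2)
    have X0: "X x = 0" if "x \<in> U - K" for x
      using fixed[OF s that] by (simp add: X_def)
    have N0: "N x = 0" if "x \<in> U - K" for x
      using laplacian_cong_open[OF openUK that fixed[OF s]] N[of x] that by (simp add: L_def)
    have tens: "tension d (\<Phi> s) x = tangent_proj d (\<Phi> s x) (laplacian (\<Phi> s) x)"
      "\<tau> x = tangent_proj d (\<phi> x) (L x)" for x
      by (simp_all add: tension_eq \<tau>_def L_def)
    define J0 where "J0 x = 1/2 * (norm (tension d (\<Phi> s) x))\<^sup>2 - 1/2 * (norm (\<tau> x))\<^sup>2" for x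
    \<comment> \<open>Subtracting the integrand of Green's identity leaves the integral unchanged and makes the density quadratically small.\<close>
    define J where "J x = J0 x - (\<tau> x \<bullet> N x - laplacian \<tau> x \<bullet> X x)" for x
    have contJ0: "continuous_on U J0"
      unfolding J0_def tens tangent_proj_def
      by (intro continuous_intros cont contL phi C2\<Phi> s)
    have cont\<tau>: "continuous_on U \<tau>" "continuous_on U (laplacian \<tau>)"
      using cont[OF tau] by (simp_all add: \<tau>_def)
    have contNX: "continuous_on U N" "continuous_on U X"
      using cont[OF C2X] by (simp_all add: N_def)
    have J00: "J0 x = 0" if "x \<in> U - K" for x
      using fixed[OF s that] N0[OF that] N[of x] that by (simp add: J0_def tens)
    have J_0: "J x = 0" if "x \<in> U - K" for x
      using J00 N0 X0 that by (simp add: J_def)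
    have intJ0: "set_integrable lborel U J0"
      by (rule set_integrable_compact_support[OF K contJ0 J00])
    have int1: "set_integrable lborel U (\<lambda>x. \<tau> x \<bullet> N x)"
      by (rule set_integrable_compact_support[OF K]) (auto intro!: continuous_intros cont\<tau> contNX simp: N0)
    have int2: "set_integrable lborel U (\<lambda>x. laplacian \<tau> x \<bullet> X x)"
      by (rule set_integrable_compact_support[OF K]) (auto intro!: continuous_intros cont\<tau> contNX simp: X0)
    have green: "(LINT x:U|lborel. \<tau> x \<bullet> N x) = (LINT x:U|lborel. laplacian \<tau> x \<bullet> X x)"
      unfolding N_def using green_identity[OF U K _ C2X X0] tau by (simp add: \<tau>_def)
    have int\<tau>: "set_integrable lborel U (\<lambda>x. 1/2 * (norm (\<tau> x))\<^sup>2)"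
      using energy by (simp add: \<tau>_def)
    have E0: "bienergy d U (\<Phi> 0) = (LINT x:U|lborel. 1/2 * (norm (\<tau> x))\<^sup>2)"
    proof -
      have "tension d (\<Phi> 0) x = \<tau> x" if "x \<in> U" for x
        using L0[OF that] \<Phi>0[OF that] by (simp add: tension_eq tens)
      then have "(LINT x:U|lborel. (norm (tension d (\<Phi> 0) x))\<^sup>2) = (LINT x:U|lborel. (norm (\<tau> x))\<^sup>2)"
        using U by (intro set_lebesgue_integral_cong) auto
      then show ?thesis
        by (simp add: bienergy_def)
    qed
    have "bienergy d U (\<Phi> s) = (LINT x:U|lborel. J0 x + 1/2 * (norm (\<tau> x))\<^sup>2)"
      by (simp add: bienergy_def J0_def)
    also have "\<dots> = (LINT x:U|lborel. J0 x) + (LINT x:U|lborel. 1/2 * (norm (\<tau> x))\<^sup>2)"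
      by (rule set_integral_add[OF intJ0 int\<tau>])
    finally have "bienergy d U (\<Phi> s) - bienergy d U (\<Phi> 0) = (LINT x:U|lborel. J0 x)"
      by (simp add: E0)
    also have "\<dots> = (LINT x:U|lborel. J x)"
      unfolding J_def using green intJ0 int1 int2 by (simp add: set_integral_diff)
    also have "\<dots> = (LINT x|lborel. indicator K x * J x)"
      unfolding set_lebesgue_integral_def using J_0 K(2)
      by (intro Bochner_Integration.integral_cong) (auto simp: indicator_def)
    finally have diff: "bienergy d U (\<Phi> s) - bienergy d U (\<Phi> 0) = \<dots>" .
    have J_bound: "\<bar>J x\<bar> \<le> C * s\<^sup>2" if x: "x \<in> K" for x
    proof -
      have xU: "x \<in> U"
        using x K by auto
      have sr: "\<bar>s\<bar> \<le> r"
        using that \<open>\<bar>s\<bar> < r\<close> by simp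
      have rem: "\<bar>J0 x - \<tau> x \<bullet> N x + d\<^sup>2 * (L x \<bullet> \<phi> x) * (L x \<bullet> X x)\<bar>
        \<le> (B\<^sup>2 / 2 + d * m * B\<^sup>2 + d\<^sup>2 / 2 * (B / d + m * B + B\<^sup>2)\<^sup>2) * \<bar>s\<bar>\<^sup>2"
        unfolding J0_def tens N[OF xU] X_def
        using incr[OF sr x] r sr B0 by (intro bienergy_density_remainder[OF d sphere0[OF xU] sphere[OF s xU] m[OF x]]) auto
      have "(laplacian \<tau> x - (d\<^sup>2 * (L x \<bullet> \<phi> x)) *\<^sub>R L x) \<bullet> X x = - \<mu> x * (norm (X x))\<^sup>2 / 2"
      proof -
        \<comment> \<open>Both values lie on the sphere, so their difference is normal to it only to second order.\<close>
        have "\<phi> x \<bullet> \<phi> x = \<Phi> s x \<bullet> \<Phi> s x"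
          using sphere[OF s xU] sphere0[OF xU] by (simp add: dot_square_norm)
        then have "\<phi> x \<bullet> X x = - (norm (X x))\<^sup>2 / 2"
          unfolding power2_norm_eq_inner X_def by (simp add: inner_diff inner_commute)
        then show ?thesis
          unfolding normal[OF xU] by simp
      qed
      then have "J x = (J0 x - \<tau> x \<bullet> N x + d\<^sup>2 * (L x \<bullet> \<phi> x) * (L x \<bullet> X x)) - \<mu> x * (norm (X x))\<^sup>2 / 2"
        by (simp add: J_def inner_diff_left)
      moreover have "\<bar>\<mu> x * (norm (X x))\<^sup>2 / 2\<bar> \<le> l * B\<^sup>2 / 2 * s\<^sup>2"
      proof -
        have "(norm (X x))\<^sup>2 \<le> (B * \<bar>s\<bar>)\<^sup>2"
          using incr(1)[OF sr x] by (intro power_mono) (auto simp: X_def)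
        then have "\<bar>\<mu> x\<bar> * (norm (X x))\<^sup>2 \<le> l * (B * \<bar>s\<bar>)\<^sup>2"
          using l[OF x] by (intro mult_mono) auto
        then show ?thesis
          by (simp add: abs_mult power_mult_distrib)
      qed
      ultimately show ?thesis
        using rem by (simp add: C_def algebra_simps)
    qed
    have Kfin: "emeasure lborel K < \<infinity>"
      using emeasure_bounded_finite[OF compact_imp_bounded[OF K(1)]] .
    have intK: "integrable lborel (\<lambda>x. indicator K x * (C * s\<^sup>2))"
      using Kfin K(1) by (intro integrable_mult_left integrable_real_indicator) (auto simp: borel_compact)
    have intJ: "integrable lborel (\<lambda>x. indicator K x * J x)"
    proof -
      have "continuous_on K J"
        unfolding J_def using contJ0 cont\<tau> contNX K(2)
        by (intro continuous_intros) (auto intro: continuous_on_subset)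
      from borel_integrable_compact[OF K(1) this] show ?thesis
        by simp
    qed
    have "\<bar>LINT x|lborel. indicator K x * J x\<bar> \<le> (LINT x|lborel. \<bar>indicator K x * J x\<bar>)"
      by (rule integral_abs_bound)
    also have "\<dots> \<le> (LINT x|lborel. indicator K x * (C * s\<^sup>2))"
      using J_bound by (intro integral_mono integrable_abs intJ intK) (auto simp: indicator_def)
    also have "\<dots> = C * measure lborel K * s\<^sup>2"
      using K(1) by (simp add: borel_compact)
    finally show ?thesis
      by (simp add: diff)
  qed
  then show ?thesis
    by (rule quadratic_increment_imp_derivative_0[OF r(1)])
qed

section \<open>The second variation along rotationally symmetric maps\<close>

lemma sin_double_arctan: "sin (2 * arctan y) = 2 * y / (1 + y\<^sup>2)"
proof -
  have "sqrt (1 + y\<^sup>2) * sqrt (1 + y\<^sup>2) = 1 + y\<^sup>2"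
    by (simp add: add_nonneg_nonneg)
  then show ?thesis
    by (simp add: sin_double sin_arctan cos_arctan)
qed

lemma cos_double_arctan: "cos (2 * arctan y) = (1 - y\<^sup>2) / (1 + y\<^sup>2)"
proof -
  have "1 + y\<^sup>2 > 0"
    by (simp add: add_pos_nonneg)
  then show ?thesis
    by (simp add: cos_double sin_arctan cos_arctan power_divide diff_divide_distrib)
qed

lemma at_within_atMost_neq_bot: "at (t::real) within {..T} \<noteq> bot" if "t \<le> T"
proof -
  have "t islimpt {t - 1<..<t}"
    by (rule islimpt_greaterThanLessThan2) simp
  then have "t islimpt {..T}"
    by (rule islimpt_subset) (use that in auto)
  then show ?thesis
    by (simp add: trivial_limit_within)
qed

lemma ddt_eq:
  assumes "t \<le> T" "(f has_real_derivative D) (at t within {..T})"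
  shows "ddt T f t = D"
  unfolding ddt_def using assms at_within_atMost_neq_bot
  by (intro vector_derivative_within) (auto simp: has_real_derivative_iff_has_vector_derivative)

lemma ddt_ddt_eq:
  assumes "\<And>t. t \<le> T \<Longrightarrow> (f has_real_derivative f1 t) (at t within {..T})"
    and "\<And>t. t \<le> T \<Longrightarrow> (f1 has_real_derivative f2 t) (at t within {..T})" and "t \<le> T"
  shows "ddt T (ddt T f) t = f2 t"
proof (rule ddt_eq[OF assms(3)])
  show "(ddt T f has_real_derivative f2 t) (at t within {..T})"
    using ddt_eq[OF _ assms(1)] assms(3)
    by (intro has_field_derivative_transform_within[OF assms(2), of t 1]) auto
qed

text \<open>The one-sided derivatives on the half line are those of any smooth extension, so they are again
  differentiable and continuous up to the endpoint.\<close>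

lemma smooth_on_atMost_derivatives:
  fixes V :: "real \<Rightarrow> real"
  assumes "smooth_on {..T} V"
  obtains V1 V2 where
    "\<And>t. t \<le> T \<Longrightarrow> (V has_real_derivative V1 t) (at t within {..T})"
    "\<And>t. t \<le> T \<Longrightarrow> (V1 has_real_derivative V2 t) (at t within {..T})"
    "continuous_on {..T} V2"
proof -
  obtain U g where U: "open U" "{..T} \<subseteq> U" and g: "\<And>k. Ck_on k U g" and gV: "\<And>t. t \<le> T \<Longrightarrow> g t = V t"
    using assms unfolding smooth_on_def by (metis atMost_iff)
  define D :: "(real \<Rightarrow> real) \<Rightarrow> real \<Rightarrow> real" where "D f t = frechet_derivative f (at t) 1" for f t
  have D: "(f has_real_derivative D f t) (at t within {..T})"
    if "Ck_on (Suc k) U f" "t \<le> T" for f k t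
  proof -
    have der: "(f has_derivative frechet_derivative f (at t)) (at t)"
      using Ck_on_differentiable_at[OF U(1) that(1)] U(2) that(2) by auto
    have "frechet_derivative f (at t) h = D f t * h" for h
    proof -
      have "frechet_derivative f (at t) (h *\<^sub>R 1) = h *\<^sub>R frechet_derivative f (at t) 1"
        by (rule linear_scale[OF has_derivative_linear[OF der]])
      then show ?thesis
        by (simp add: D_def)
    qed
    then have "frechet_derivative f (at t) = (*) (D f t)"
      by (rule ext)
    then have "(f has_derivative (*) (D f t)) (at t within {..T})"
      using has_derivative_at_withinI[OF der] by simp
    then show ?thesis
      by (simp only: has_field_derivative_def)
  qed
  have CD: "Ck_on k U (D f)" if "Ck_on (Suc k) U f" for f k
    using that by (simp add: D_def[abs_def])
  show thesis
  proof
    show "(V has_real_derivative D g t) (at t within {..T})" if "t \<le> T" for t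
      using that gV by (intro has_field_derivative_transform_within[OF D[OF g that], of 1]) auto
    show "(D g has_real_derivative D (D g) t) (at t within {..T})" if "t \<le> T" for t
      using D[OF CD[OF g] that] .
    show "continuous_on {..T} (D (D g))"
      using Ck_on_imp_continuous_on[OF CD[OF CD[OF g]]] U(2) continuous_on_subset by blast
  qed
qed

lemma q_eq:
  assumes "d \<noteq> 0"
  shows "q d \<alpha> = sin (2 * (d * \<alpha>)) / (2 * d)"
proof -
  have "(h d has_real_derivative cos (d * \<alpha>)) (at \<alpha>)"
    unfolding h_def[abs_def] using assms by (auto intro!: derivative_eq_intros)
  then have "deriv (h d) \<alpha> = cos (d * \<alpha>)"
    by (rule DERIV_imp_deriv)
  then show ?thesis
    using assms by (simp add: q_def h_def sin_double)
qed

lemma has_derivative_integral_parameter: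
  fixes f fx :: "real \<Rightarrow> real \<Rightarrow> real"
  assumes "\<And>s t. ((\<lambda>s. f s t) has_real_derivative fx s t) (at s)" "\<And>s. f s integrable_on {a..b}"
    and "continuous_on (UNIV \<times> {a..b}) (\<lambda>(s, t). fx s t)"
  shows "((\<lambda>s. integral {a..b} (f s)) has_real_derivative integral {a..b} (fx s)) (at s)"
proof -
  have "((\<lambda>s. integral (cbox a b) (f s)) has_real_derivative integral (cbox a b) (fx s)) (at s within UNIV)"
    by (rule leibniz_rule_field_derivative) (use assms in auto)
  then show ?thesis
    by simp
qed

text \<open>For a general profile \<open>b\<close>. Outside the support of \<open>V\<close> the integrand does not depend on \<open>s\<close>, so the
  \<open>s\<close>-dependent part of the integral over the arbitrary compact set \<open>K\<close> is an integral over a compact interval, where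
  differentiation under the integral sign applies. Squaring \<open>N\<close> contributes \<open>N1\<^sup>2 + N N2\<close>, where \<open>N1\<close> and \<open>N2\<close> are the
  first two derivatives of \<open>N\<close> in \<open>s\<close>.\<close>

lemma E2_second_variation:
  fixes b b1 b2 :: "real \<Rightarrow> real"
  assumes d: "d \<noteq> 0"
    and b: "\<And>t. t \<le> T \<Longrightarrow> (b has_real_derivative b1 t) (at t within {..T})"
      "\<And>t. t \<le> T \<Longrightarrow> (b1 has_real_derivative b2 t) (at t within {..T})" "continuous_on {..T} b2"
    and V: "\<And>t. t \<le> T \<Longrightarrow> (V has_real_derivative V1 t) (at t within {..T})"
      "\<And>t. t \<le> T \<Longrightarrow> (V1 has_real_derivative V2 t) (at t within {..T})" "continuous_on {..T} V2"
    and K: "compact K" "support_in T V \<subseteq> K" "K \<subseteq> {..T}" "K \<subseteq> {a..T}"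
  shows "has_second_derivative (\<lambda>s. E2 d T K (\<lambda>t. b t + s * V t))
    (integral {a..T} (\<lambda>t. (V2 t + 2 * V1 t - 3 * cos (2 * (d * b t)) * V t)\<^sup>2
      + (b2 t + 2 * b1 t - 3 * q d (b t)) * (6 * d * sin (2 * (d * b t)) * (V t)\<^sup>2))) 0"
proof -
  define N where "N s t = b2 t + 2 * b1 t + s * (V2 t + 2 * V1 t) - 3 * sin (2 * (d * (b t + s * V t))) / (2 * d)"
    for s t
  define N1 where "N1 s t = V2 t + 2 * V1 t - 3 * cos (2 * (d * (b t + s * V t))) * V t" for s t
  define N2 where "N2 s t = 6 * d * sin (2 * (d * (b t + s * V t))) * (V t)\<^sup>2" for s t
  have N: "((\<lambda>s. N s t) has_real_derivative N1 s t) (at s)" for s t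
    unfolding N_def N1_def using d by (auto intro!: derivative_eq_intros simp: field_simps)
  have N1: "((\<lambda>s. N1 s t) has_real_derivative N2 s t) (at s)" for s t
    unfolding N1_def N2_def by (auto intro!: derivative_eq_intros simp: field_simps power2_eq_square)
  have contT: "continuous_on {..T} f" if "\<And>t. t \<le> T \<Longrightarrow> (f has_real_derivative f1 t) (at t within {..T})"
    for f f1 :: "real \<Rightarrow> real"
    using DERIV_continuous_on[of "{..T}" f f1] that by simp
  note cont = contT[OF b(1)] contT[OF b(2)] b(3) contT[OF V(1)] contT[OF V(2)] V(3)
  have integrand: "ddt T (ddt T (\<lambda>t. b t + s * V t)) t + 2 * ddt T (\<lambda>t. b t + s * V t) t
      - 3 * q d (b t + s * V t) = N s t" if "t \<le> T" for s t
  proof -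
    have 1: "((\<lambda>t. b t + s * V t) has_real_derivative b1 t + s * V1 t) (at t within {..T})" if "t \<le> T" for t
      by (intro DERIV_add DERIV_cmult b V that)
    have 2: "((\<lambda>t. b1 t + s * V1 t) has_real_derivative b2 t + s * V2 t) (at t within {..T})" if "t \<le> T" for t
      by (intro DERIV_add DERIV_cmult b V that)
    show ?thesis
      using ddt_eq[OF that 1[OF that]] ddt_ddt_eq[OF 1 2 that] by (simp add: N_def q_eq[OF d] algebra_simps)
  qed
  have off: "N s t = N 0 t" if t: "t \<le> T" "t \<notin> support_in T V" for s t
  proof -
    obtain e where e: "e > 0" "\<And>t'. dist t' t < e \<Longrightarrow> t' \<notin> support_in T V"
      using t(2) open_dist[of "- support_in T V"] closed_closure[of "{t. t \<le> T \<and> V t \<noteq> 0}"]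
      unfolding support_in_def open_closed[symmetric] by (auto simp: open_Compl)
    have V0: "V t' = 0" if "t' \<le> T" "dist t' t < e" for t'
      using e(2)[OF that(2)] closure_subset[of "{t. t \<le> T \<and> V t \<noteq> 0}"] that(1)
      unfolding support_in_def by auto
    have V10: "V1 t' = 0" if t': "t' \<le> T" "dist t' t < e" for t'
    proof -
      have "(V has_real_derivative 0) (at t' within {..T})"
      proof (rule has_field_derivative_transform_within[of "\<lambda>t. 0" _ _ _ "e - dist t' t"])
        show "0 = V x" if "x \<in> {..T}" "dist x t' < e - dist t' t" for x
          using V0[of x] that dist_triangle[of x t t'] by auto
      qed (use t' in auto)
      then show ?thesis
        using ddt_eq[OF t'(1)] V(1)[OF t'(1)] by metis
    qed
    have "(V1 has_real_derivative 0) (at t within {..T})"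
    proof (rule has_field_derivative_transform_within[of "\<lambda>t. 0" _ _ _ e])
      show "0 = V1 x" if "x \<in> {..T}" "dist x t < e" for x
        using V10[of x] that by auto
    qed (use t e in auto)
    then have "V2 t = 0"
      using ddt_eq[OF t(1)] V(2)[OF t(1)] by metis
    then show ?thesis
      using V0[of t] V10[of t] t(1) e(1) by (simp add: N_def)
  qed
  have contN: "continuous_on {..T} (N s)" for s
    unfolding N_def[abs_def] using d by (intro continuous_intros cont) auto
  define I where "I s = integral {a..T} (\<lambda>t. (N s t)\<^sup>2 - (N 0 t)\<^sup>2)" for s
  have E2: "E2 d T K (\<lambda>t. b t + s * V t) = E2 d T K b + 1/2 * I s" for s
  proof -
    have E2N: "E2 d T K (\<lambda>t. b t + s * V t) = 1/2 * (LINT t:K|lborel. (N s t)\<^sup>2)" for s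
      unfolding E2_def using K integrand
      by (intro arg_cong[of _ _ "\<lambda>x. 1/2 * x"] set_lebesgue_integral_cong) (auto simp: borel_compact)
    have int: "set_integrable lborel C (\<lambda>t. (N s t)\<^sup>2)" if "compact C" "C \<subseteq> {..T}" for C s
      unfolding set_integrable_def
      by (intro borel_integrable_compact that continuous_intros continuous_on_subset[OF contN])
    have "(LINT t:K|lborel. (N s t)\<^sup>2) = (LINT t:K|lborel. (N 0 t)\<^sup>2) + (LINT t:K|lborel. (N s t)\<^sup>2 - (N 0 t)\<^sup>2)"
      using int[OF K(1,3)] by simp
    also have "(LINT t:K|lborel. (N s t)\<^sup>2 - (N 0 t)\<^sup>2) = (LINT t:{a..T}|lborel. (N s t)\<^sup>2 - (N 0 t)\<^sup>2)"
    proof -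
      have "N s t = N 0 t" if "t \<in> {a..T}" "t \<notin> K" for t
        using off[of t s] that K(2) by auto
      then show ?thesis
        unfolding set_lebesgue_integral_def using K(4)
        by (intro Bochner_Integration.integral_cong) (auto simp: indicator_def)
    qed
    also have "\<dots> = I s"
      unfolding I_def using int[of "{a..T}"] by (intro set_borel_integral_eq_integral) auto
    finally show ?thesis
      using E2N[of s] E2N[of 0] by simp
  qed
  have cont2: "continuous_on (UNIV \<times> {a..T}) (\<lambda>z. f (snd z))" if "continuous_on {..T} f" for f :: "real \<Rightarrow> real"
    by (rule continuous_on_compose2[OF that]) (auto intro!: continuous_intros)
  note cont2 = cont[THEN cont2]
  have contNN: "continuous_on (UNIV \<times> {a..T}) (\<lambda>z. N (fst z) (snd z))"
    "continuous_on (UNIV \<times> {a..T}) (\<lambda>z. N1 (fst z) (snd z))"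
    "continuous_on (UNIV \<times> {a..T}) (\<lambda>z. N2 (fst z) (snd z))"
    unfolding N_def N1_def N2_def using d by (intro continuous_intros cont2; simp)+
  have slice: "continuous_on {a..T} (f s)" if "continuous_on (UNIV \<times> {a..T}) (\<lambda>z. f (fst z) (snd z))"
    for f :: "real \<Rightarrow> real \<Rightarrow> real" and s
  proof -
    have "continuous_on {a..T} (\<lambda>t. (s, t))"
      by (intro continuous_intros)
    from continuous_on_compose2[OF that this] show ?thesis
      by auto
  qed
  have I1: "(I has_real_derivative integral {a..T} (\<lambda>t. 2 * N s t * N1 s t)) (at s)" for s
    unfolding I_def[abs_def]
  proof (rule has_derivative_integral_parameter[where f="\<lambda>s t. (N s t)\<^sup>2 - (N 0 t)\<^sup>2" and fx="\<lambda>s t. 2 * N s t * N1 s t"])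
    show "((\<lambda>s. (N s t)\<^sup>2 - (N 0 t)\<^sup>2) has_real_derivative 2 * N s t * N1 s t) (at s)" for s t
      by (auto intro!: derivative_eq_intros N)
    show "(\<lambda>t. (N s t)\<^sup>2 - (N 0 t)\<^sup>2) integrable_on {a..T}" for s
      by (intro integrable_continuous_interval continuous_intros slice[of N] contNN)
    show "continuous_on (UNIV \<times> {a..T}) (\<lambda>(s, t). 2 * N s t * N1 s t)"
      unfolding split_beta by (intro continuous_intros contNN)
  qed
  have I2: "((\<lambda>s. integral {a..T} (\<lambda>t. 2 * N s t * N1 s t)) has_real_derivative
      integral {a..T} (\<lambda>t. 2 * (N1 s t * N1 s t + N s t * N2 s t))) (at s)" for s
  proof (rule has_derivative_integral_parameter[where f="\<lambda>s t. 2 * N s t * N1 s t"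
        and fx="\<lambda>s t. 2 * (N1 s t * N1 s t + N s t * N2 s t)"])
    show "((\<lambda>s. 2 * N s t * N1 s t) has_real_derivative 2 * (N1 s t * N1 s t + N s t * N2 s t)) (at s)" for s t
      by (auto intro!: derivative_eq_intros N N1 simp: algebra_simps)
    show "(\<lambda>t. 2 * N s t * N1 s t) integrable_on {a..T}" for s
      by (intro integrable_continuous_interval continuous_intros slice[of N] slice[of N1] contNN)
    show "continuous_on (UNIV \<times> {a..T}) (\<lambda>(s, t). 2 * (N1 s t * N1 s t + N s t * N2 s t))"
      unfolding split_beta by (intro continuous_intros contNN)
  qed
  have "((\<lambda>s. E2 d T K (\<lambda>t. b t + s * V t)) has_real_derivative
      1/2 * integral {a..T} (\<lambda>t. 2 * N s t * N1 s t)) (at s)" for s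
    unfolding E2 by (rule derivative_eq_intros I1 refl)+ simp
  moreover have "((\<lambda>s. 1/2 * integral {a..T} (\<lambda>t. 2 * N s t * N1 s t)) has_real_derivative
      1/2 * integral {a..T} (\<lambda>t. 2 * (N1 0 t * N1 0 t + N 0 t * N2 0 t))) (at 0)"
    by (intro DERIV_cmult I2)
  ultimately have "has_second_derivative (\<lambda>s. E2 d T K (\<lambda>t. b t + s * V t))
      (1/2 * integral {a..T} (\<lambda>t. 2 * (N1 0 t * N1 0 t + N 0 t * N2 0 t))) 0"
    unfolding has_second_derivative_def
    by (intro exI[of _ "\<lambda>s. 1/2 * integral {a..T} (\<lambda>t. 2 * N s t * N1 s t)"]) simp
  then show ?thesis
    unfolding integral_mult_right by (simp add: N_def N1_def N2_def q_eq[OF d] power2_eq_square)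
qed

section \<open>Stability of the conformal profile\<close>

text \<open>The conformal profile solves \<open>\<beta>' = sin (d \<beta>) / d\<close>. This makes the zeroth order term of the second variation a
  nonnegative multiple of \<open>V\<^sup>2\<close>, because \<open>d \<beta>\<close> does not exceed \<open>\<pi> / 2\<close> on the half line.\<close>

lemma conformal_profile_stable:
  assumes \<kappa>: "\<kappa> > 0" and d: "d > 0"
    and \<beta>: "\<And>t. t \<le> ln (1 / \<kappa>) \<Longrightarrow> \<beta> t = 2 / d * arctan (\<kappa> * exp t)"
  shows "equivariant_stable d (ln (1 / \<kappa>)) \<beta>"
proof -
  define T where "T = ln (1 / \<kappa>)"
  \<comment> \<open>The tangent of half the polar angle: \<open>y < 1\<close> says that the point lies before the equator.\<close>
  define y where "y t = \<kappa> * exp t" for t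
  define b1 where "b1 t = sin (d * \<beta> t) / d" for t
  define b2 where "b2 t = sin (2 * (d * \<beta> t)) / (2 * d)" for t
  have y0: "y t > 0" for t
    using \<kappa> by (simp add: y_def)
  have expT: "exp T = 1 / \<kappa>"
    using \<kappa> by (simp add: T_def exp_ln)
  have y1: "y t \<le> 1" if "t \<le> T" for t
  proof -
    have "y t \<le> \<kappa> * exp T"
      using that \<kappa> by (simp add: y_def)
    then show ?thesis
      using \<kappa> by (simp add: expT)
  qed
  have y1': "y t < 1" if "t < T" for t
  proof -
    have "y t < \<kappa> * exp T"
      using that \<kappa> by (simp add: y_def)
    then show ?thesis
      using \<kappa> by (simp add: expT)
  qed
  have d\<beta>: "d * \<beta> t = 2 * arctan (y t)" if "t \<le> T" for t
    using \<beta> that d by (simp add: T_def y_def)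
  have S: "sin (d * \<beta> t) = 2 * y t / (1 + (y t)\<^sup>2)" and C: "cos (d * \<beta> t) = (1 - (y t)\<^sup>2) / (1 + (y t)\<^sup>2)"
    if "t \<le> T" for t
    unfolding d\<beta>[OF that] by (rule sin_double_arctan cos_double_arctan)+
  have der: "(\<beta> has_real_derivative b1 t) (at t within {..T})" if "t \<le> T" for t
  proof (rule has_field_derivative_transform_within[of "\<lambda>t. 2 / d * arctan (\<kappa> * exp t)" _ _ _ 1])
    show "((\<lambda>t. 2 / d * arctan (\<kappa> * exp t)) has_real_derivative b1 t) (at t within {..T})"
      unfolding b1_def S[OF that] y_def
      by (auto intro!: derivative_eq_intros simp: divide_inverse mult_ac)
  qed (use that \<beta> in \<open>auto simp: T_def\<close>)
  have der1: "(b1 has_real_derivative b2 t) (at t within {..T})" if "t \<le> T" for t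
    unfolding b1_def[abs_def] using d
    by (auto intro!: derivative_eq_intros der[OF that] simp: b2_def b1_def sin_double)
  have "continuous_on {..T} \<beta>"
    using DERIV_continuous_on[of "{..T}" \<beta> b1] der by simp
  then have cont: "continuous_on {..T} \<beta>" "continuous_on {..T} b1" "continuous_on {..T} b2"
    unfolding b1_def[abs_def] b2_def[abs_def] using d by (auto intro!: continuous_intros)
  have weight: "(b2 t + 2 * b1 t - 3 * q d (\<beta> t)) * (6 * d * sin (2 * (d * \<beta> t)) * v\<^sup>2)
      = 24 * (sin (d * \<beta> t))\<^sup>2 * cos (d * \<beta> t) * (1 - cos (d * \<beta> t)) * v\<^sup>2" for t v
    unfolding b1_def b2_def q_eq[OF less_imp_neq[OF d, symmetric]] sin_double[of "d * \<beta> t"]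
    using d by (simp add: field_simps power2_eq_square)
  have nonneg: "0 \<le> 24 * (sin (d * \<beta> t))\<^sup>2 * cos (d * \<beta> t) * (1 - cos (d * \<beta> t)) * v\<^sup>2" if "t \<le> T" for t v
  proof -
    have "(y t)\<^sup>2 \<le> 1"
      using y0[of t] y1[OF that] by (simp add: power_le_one)
    then have "0 \<le> cos (d * \<beta> t)"
      unfolding C[OF that] by (simp add: add_pos_nonneg)
    then show ?thesis
      by simp
  qed
  have pos: "0 < 24 * (sin (d * \<beta> t))\<^sup>2 * cos (d * \<beta> t) * (1 - cos (d * \<beta> t)) * v\<^sup>2" if "t < T" "v \<noteq> 0" for t v
  proof -
    have t: "t \<le> T"
      using that by simp
    have y2: "0 < (y t)\<^sup>2" "(y t)\<^sup>2 < 1" "0 < 1 + (y t)\<^sup>2"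
      using y0[of t] y1'[OF that(1)] by (auto simp: power_less_one_iff add_pos_nonneg)
    then have "0 < sin (d * \<beta> t)" "0 < cos (d * \<beta> t)" "cos (d * \<beta> t) < 1"
      using y0[of t] unfolding S[OF t] C[OF t] by (simp_all add: divide_less_eq)
    then show ?thesis
      using that(2) by simp
  qed
  show ?thesis
    unfolding equivariant_stable_def T_def[symmetric]
  proof (intro allI impI, elim conjE)
    fix V K
    assume smooth: "smooth_on {..T} V" and nz: "\<exists>t\<le>T. V t \<noteq> 0" and VT: "V T = 0"
      and K: "compact K" "support_in T V \<subseteq> K" "K \<subseteq> {..T}"
    obtain V1 V2 where V: "\<And>t. t \<le> T \<Longrightarrow> (V has_real_derivative V1 t) (at t within {..T})"
      "\<And>t. t \<le> T \<Longrightarrow> (V1 has_real_derivative V2 t) (at t within {..T})" "continuous_on {..T} V2"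
      using smooth_on_atMost_derivatives[OF smooth] by metis
    obtain t0 where t0: "t0 < T" "V t0 \<noteq> 0"
      using nz VT by (metis order_le_less)
    obtain a where a: "K \<subseteq> {a..T}"
    proof -
      obtain r where "\<And>x. x \<in> K \<Longrightarrow> \<bar>x\<bar> \<le> r"
        using compact_imp_bounded[OF K(1)] by (auto simp: bounded_iff)
      then have "K \<subseteq> {-r..T}"
        using K(3) by force
      then show thesis
        by (rule that)
    qed
    have "t0 \<in> support_in T V"
      unfolding support_in_def using t0 closure_subset by fastforce
    then have at0: "a \<le> t0"
      using K a by auto
    define D where "D t = (V2 t + 2 * V1 t - 3 * cos (2 * (d * \<beta> t)) * V t)\<^sup>2
      + (b2 t + 2 * b1 t - 3 * q d (\<beta> t)) * (6 * d * sin (2 * (d * \<beta> t)) * (V t)\<^sup>2)" for t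
    have contV: "continuous_on {..T} V" "continuous_on {..T} V1"
      using DERIV_continuous_on[of "{..T}" V V1] DERIV_continuous_on[of "{..T}" V1 V2] V by simp_all
    have "continuous_on {..T} D"
      unfolding D_def q_eq[OF less_imp_neq[OF d, symmetric]]
      using d by (intro continuous_intros cont contV V) auto
    then have contD: "continuous_on {a..T} D"
      by (rule continuous_on_subset) auto
    have D0: "0 \<le> D t" if "t \<le> T" for t
      unfolding D_def weight using nonneg[OF that, of "V t"] by simp
    have "D t0 > 0"
      unfolding D_def weight using pos[OF t0] by (simp add: add_nonneg_pos)
    then have "integral {a..T} D \<noteq> 0"
      using integral_eq_0_iff[OF contD] D0 at0 t0 by force
    moreover have "integral {a..T} D \<ge> 0"
      using contD D0 by (intro integral_nonneg integrable_continuous_interval) auto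
    ultimately have "integral {a..T} D > 0"
      by simp
    moreover have "has_second_derivative (\<lambda>s. E2 d T K (\<lambda>t. \<beta> t + s * V t)) (integral {a..T} D) 0"
      unfolding D_def using d by (intro E2_second_variation der der1 cont V K a) auto
    ultimately show "\<exists>D>0. has_second_derivative (\<lambda>s. E2 d T K (\<lambda>t. \<beta> t + s * V t)) D 0"
      by blast
  qed
qed

section \<open>Inverse stereographic projection as a biharmonic map\<close>

lemma radial_poly_weight_algebra:
  fixes b :: "'a::euclidean_space \<times> real"
  shows "(\<lambda>x. radial \<kappa> (poly p) (poly r) x \<bullet> b) \<in> weight_algebra \<kappa>"
proof -
  have poly: "(\<lambda>x. poly p (weight \<kappa> x)) \<in> weight_algebra \<kappa>" for p
    by (induction p) (auto intro!: weight_algebra.intros)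
  have "(\<lambda>x. poly p (weight \<kappa> x) * (x \<bullet> fst b) + poly r (weight \<kappa> x) * snd b) \<in> weight_algebra \<kappa>"
    by (intro weight_algebra.add weight_algebra.mult poly weight_algebra.coord weight_algebra.const)
  then show ?thesis
    by (simp add: radial_def inner_prod_def)
qed

lemma Ck_on_radial_poly: "Ck_on k U (radial \<kappa> (poly p) (poly r))"
  by (rule Ck_on_weight_algebra[OF radial_poly_weight_algebra])

text \<open>Polynomials in the weight are preserved by the Laplacian, so it can be iterated by computing with coefficients.\<close>

lemma laplacian_radial_poly:
  fixes x :: "'a::euclidean_space"
  defines "n \<equiv> of_nat DIM('a)"
  shows "laplacian (radial \<kappa> (poly p) (poly r)) x = radial \<kappa>
    (poly (smult (\<kappa>\<^sup>2) ([:0, 0, 1:] * ([:4, -4:] * (smult 2 (pderiv p) + [:0, 1:] * pderiv (pderiv p))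
       - smult (2 * (n + 2)) (pderiv p)))))
    (poly (smult (\<kappa>\<^sup>2) ([:0, 0, 1:] * ([:4, -4:] * (smult 2 (pderiv r) + [:0, 1:] * pderiv (pderiv r))
       - smult (2 * n) (pderiv r))))) x"
  unfolding laplacian_radial[OF poly_DERIV poly_DERIV poly_DERIV poly_DERIV] n_def radial_def
  by (simp add: power2_eq_square algebra_simps)

text \<open>Inverse stereographic projection onto the sphere of radius \<open>1 / d\<close>, precomposed with the dilation by
  \<open>\<kappa>\<close>: the point \<open>x\<close> goes to \<open>(2 \<kappa> w x, 2 w - 1) / d\<close>.\<close>

definition inv_stereo :: "real \<Rightarrow> real \<Rightarrow> 'a::euclidean_space \<Rightarrow> 'a \<times> real" where
  "inv_stereo d \<kappa> = radial \<kappa> (poly [:0, 2 * \<kappa> / d:]) (poly [:- 1 / d, 2 / d:])"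

lemma weight_mult_norm: "\<kappa>\<^sup>2 * weight \<kappa> x * (x \<bullet> x) = 1 - weight \<kappa> x"
  using weight_denominator_pos[of \<kappa> x] by (simp add: weight_def field_simps)

lemma norm_inv_stereo:
  assumes "d > 0"
  shows "norm (inv_stereo d \<kappa> x) = 1 / d"
proof -
  define u where "u = weight \<kappa> x"
  have "inv_stereo d \<kappa> x \<bullet> inv_stereo d \<kappa> x = (4 * u * (\<kappa>\<^sup>2 * u * (x \<bullet> x)) + (2 * u - 1)\<^sup>2) / d\<^sup>2"
    using assms by (simp add: inv_stereo_def radial_def u_def[symmetric] power2_eq_square field_simps)
  also have "\<dots> = (1 / d)\<^sup>2"
    unfolding u_def weight_mult_norm by (simp add: power2_eq_square algebra_simps)
  finally show ?thesis
    using assms by (simp add: norm_eq_sqrt_inner)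
qed

lemma inv_stereo_conformal:
  fixes x :: "'a::euclidean_space"
  assumes "\<kappa> > 0" "d > 0"
  obtains D where "(inv_stereo d \<kappa> has_derivative D) (at x)"
    "\<And>v w. D v \<bullet> D w = (2 * \<kappa> * weight \<kappa> x / d)\<^sup>2 * (v \<bullet> w)"
proof -
  define u where "u = weight \<kappa> x"
  define D where "D v = ((- 2 * \<kappa>\<^sup>2 * u\<^sup>2 * (2 * \<kappa> / d) * (x \<bullet> v)) *\<^sub>R x + (2 * \<kappa> / d * u) *\<^sub>R v,
      - 2 * \<kappa>\<^sup>2 * u\<^sup>2 * (2 / d) * (x \<bullet> v))" for v
  have "(radial \<kappa> (poly [:0, 2 * \<kappa> / d:]) (poly [:- 1 / d, 2 / d:]) has_derivative D) (at x)"
    by (rule has_derivative_eq_rhs[OF radial_has_derivative[OF poly_DERIV poly_DERIV]])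
      (simp add: D_def u_def pderiv_pCons fun_eq_iff)
  then have "(inv_stereo d \<kappa> has_derivative D) (at x)"
    by (simp add: inv_stereo_def)
  moreover have "D v \<bullet> D w = (2 * \<kappa> * u / d)\<^sup>2 * (v \<bullet> w)" for v w
  proof -
    define A where "A = 4 * \<kappa>\<^sup>2 * \<kappa> * u\<^sup>2 / d"
    define C where "C = 4 * \<kappa>\<^sup>2 * u\<^sup>2 / d"
    have D: "D v = ((2 * \<kappa> * u / d) *\<^sub>R v - (A * (x \<bullet> v)) *\<^sub>R x, - C * (x \<bullet> v))" for v
      by (simp add: D_def A_def C_def mult_ac)
    have "D v \<bullet> D w = (2 * \<kappa> * u / d)\<^sup>2 * (v \<bullet> w)
        + (A\<^sup>2 * (x \<bullet> x) - 2 * (2 * \<kappa> * u / d) * A + C\<^sup>2) * ((x \<bullet> v) * (x \<bullet> w))"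
      unfolding D by (simp add: inner_diff_left inner_diff_right inner_commute[of v x] algebra_simps power2_eq_square)
    also have "A\<^sup>2 * (x \<bullet> x) - 2 * (2 * \<kappa> * u / d) * A + C\<^sup>2
        = 16 * \<kappa>\<^sup>2 * \<kappa>\<^sup>2 * u\<^sup>2 * u * (\<kappa>\<^sup>2 * u * (x \<bullet> x) + u - 1) / d\<^sup>2"
      using assms(2) by (simp add: A_def C_def field_simps power2_eq_square)
    finally have "D v \<bullet> D w = (2 * \<kappa> * u / d)\<^sup>2 * (v \<bullet> w)
        + 16 * \<kappa>\<^sup>2 * \<kappa>\<^sup>2 * u\<^sup>2 * u * (\<kappa>\<^sup>2 * u * (x \<bullet> x) + u - 1) / d\<^sup>2 * ((x \<bullet> v) * (x \<bullet> w))" .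
    then show ?thesis
      unfolding u_def weight_mult_norm by simp
  qed
  ultimately show thesis
    using that unfolding u_def by blast
qed

text \<open>Although the map is conformal it is not harmonic: in dimension 4 the Laplacian has a tangential part.
  The first identity is \<open>|d\<phi>|\<^sup>2 = 4 \<rho>\<^sup>2\<close> for the conformal factor \<open>\<rho> = 2 \<kappa> w / d\<close>, in the form
  \<open>\<langle>\<Delta>\<phi>, \<phi>\<rangle> = - |d\<phi>|\<^sup>2\<close>.\<close>

lemma inv_stereo_tension:
  fixes x :: "'a::euclidean_space"
  assumes dim: "DIM('a) = 4" and d: "d > 0"
  shows "laplacian (inv_stereo d \<kappa>) x \<bullet> inv_stereo d \<kappa> x = - 16 * (\<kappa> * weight \<kappa> x / d)\<^sup>2"
    and "tension d (inv_stereo d \<kappa>) x = radial \<kappa> (poly [:0, 0, - 8 * \<kappa> ^ 3 / d, 16 * \<kappa> ^ 3 / d:])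
      (poly [:0, 0, - 16 * \<kappa>\<^sup>2 / d, 16 * \<kappa>\<^sup>2 / d:]) x"
proof -
  define u where "u = weight \<kappa> x"
  have lap: "laplacian (inv_stereo d \<kappa>) x =
      ((- 8 * \<kappa> ^ 3 / d * u\<^sup>2 * (2 * u + 1)) *\<^sub>R x, - 16 * \<kappa>\<^sup>2 / d * u ^ 3)"
    unfolding inv_stereo_def laplacian_radial_poly dim radial_def u_def[symmetric] prod.inject
    by (intro conjI arg_cong[of _ _ "\<lambda>a. a *\<^sub>R x"])
      (use d in \<open>simp_all add: pderiv_pCons field_simps power2_eq_square power3_eq_cube\<close>)
  have "laplacian (inv_stereo d \<kappa>) x \<bullet> inv_stereo d \<kappa> x
      = (- 16 * \<kappa>\<^sup>2 * u\<^sup>2 * (2 * u + 1) * (\<kappa>\<^sup>2 * u * (x \<bullet> x)) - 16 * \<kappa>\<^sup>2 * u ^ 3 * (2 * u - 1)) / d\<^sup>2"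
    unfolding lap using d
    by (simp add: inv_stereo_def radial_def u_def[symmetric] field_simps power2_eq_square power3_eq_cube)
  also have "\<dots> = - 16 * (\<kappa> * u / d)\<^sup>2"
    unfolding u_def weight_mult_norm by (simp add: power_divide power2_eq_square power3_eq_cube algebra_simps flip: diff_divide_distrib add_divide_distrib)
  finally show inner: "laplacian (inv_stereo d \<kappa>) x \<bullet> inv_stereo d \<kappa> x = - 16 * (\<kappa> * weight \<kappa> x / d)\<^sup>2"
    by (simp add: u_def)
  show "tension d (inv_stereo d \<kappa>) x = radial \<kappa> (poly [:0, 0, - 8 * \<kappa> ^ 3 / d, 16 * \<kappa> ^ 3 / d:])
      (poly [:0, 0, - 16 * \<kappa>\<^sup>2 / d, 16 * \<kappa>\<^sup>2 / d:]) x"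
  proof -
    have "d\<^sup>2 * (- 16 * (\<kappa> * u / d)\<^sup>2) = - (16 * \<kappa>\<^sup>2 * u\<^sup>2)"
      using d by (simp add: power_divide power_mult_distrib)
    then have "tension d (inv_stereo d \<kappa>) x
        = laplacian (inv_stereo d \<kappa>) x + (16 * \<kappa>\<^sup>2 * u\<^sup>2) *\<^sub>R inv_stereo d \<kappa> x"
      by (simp add: tension_eq tangent_proj_def inner u_def)
    also have "\<dots> = ((- 8 * \<kappa> ^ 3 / d * u\<^sup>2 * (2 * u + 1) + 16 * \<kappa>\<^sup>2 * u\<^sup>2 * (2 * \<kappa> / d * u)) *\<^sub>R x,
        - 16 * \<kappa>\<^sup>2 / d * u ^ 3 + 16 * \<kappa>\<^sup>2 * u\<^sup>2 * ((2 * u - 1) / d))"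
      unfolding lap by (simp add: inv_stereo_def radial_def scaleR_left_distrib scaleR_left_diff_distrib diff_divide_distrib mult_ac flip: u_def)
    also have "\<dots> = radial \<kappa> (poly [:0, 0, - 8 * \<kappa> ^ 3 / d, 16 * \<kappa> ^ 3 / d:])
        (poly [:0, 0, - 16 * \<kappa>\<^sup>2 / d, 16 * \<kappa>\<^sup>2 / d:]) x"
      unfolding radial_def u_def[symmetric] prod.inject
      by (intro conjI arg_cong[of _ _ "\<lambda>a. a *\<^sub>R x"])
        (use d in \<open>simp_all add: field_simps power2_eq_square power3_eq_cube\<close>)
    finally show ?thesis .
  qed
qed

text \<open>Computing the coefficients of \<open>\<Delta>\<tau>\<close> shows that it is a multiple of \<open>\<phi>\<close> minus \<open>16 \<kappa>\<^sup>2 w\<^sup>2 \<tau>\<close>. The first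
  part is normal to the sphere, and the coefficient of the second is \<open>d\<^sup>2 \<langle>\<Delta>\<phi>, \<phi>\<rangle>\<close>.\<close>

lemma inv_stereo_biharmonic:
  fixes x :: "'a::euclidean_space"
  assumes dim: "DIM('a) = 4" and d: "d > 0"
  shows "tangent_proj d (inv_stereo d \<kappa> x) (laplacian (tension d (inv_stereo d \<kappa>)) x)
    = (d\<^sup>2 * (laplacian (inv_stereo d \<kappa>) x \<bullet> inv_stereo d \<kappa> x)) *\<^sub>R tension d (inv_stereo d \<kappa>) x"
proof -
  define u where "u = weight \<kappa> x"
  define F where "F = inv_stereo d \<kappa> x"
  define \<tau> where "\<tau> = tension d (inv_stereo d \<kappa>) x"
  note tens = inv_stereo_tension(2)[OF dim d, of \<kappa>, abs_def]
  have FF: "d\<^sup>2 * (F \<bullet> F) = 1"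
    using norm_inv_stereo[OF d, of \<kappa> x] d by (simp add: F_def dot_square_norm power_divide)
  have \<tau>F: "\<tau> \<bullet> F = 0"
    unfolding \<tau>_def tension_eq F_def[symmetric] tangent_proj_def using FF by (simp add: inner_diff_left mult_ac)
  have lap: "laplacian (tension d (inv_stereo d \<kappa>)) x
      = (- 128 * \<kappa> ^ 4 * u ^ 3 * (2 * u - 1)) *\<^sub>R F - (16 * \<kappa>\<^sup>2 * u\<^sup>2) *\<^sub>R \<tau>"
    using d unfolding \<tau>_def tens laplacian_radial_poly dim
    by (simp add: F_def inv_stereo_def radial_def pderiv_pCons u_def[symmetric] field_simps
        power2_eq_square power3_eq_cube power4_eq_xxxx flip: scaleR_left_distrib scaleR_left_diff_distrib)
  have proj: "tangent_proj d F (c *\<^sub>R F - e *\<^sub>R \<tau>) = - e *\<^sub>R \<tau>" for c e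
  proof -
    have "d\<^sup>2 * ((c *\<^sub>R F - e *\<^sub>R \<tau>) \<bullet> F) = c * (d\<^sup>2 * (F \<bullet> F)) - d\<^sup>2 * e * (\<tau> \<bullet> F)"
      by (simp add: inner_diff_left algebra_simps)
    then show ?thesis
      by (simp add: tangent_proj_def FF \<tau>F)
  qed
  have "d\<^sup>2 * (laplacian (inv_stereo d \<kappa>) x \<bullet> inv_stereo d \<kappa> x) = - (16 * \<kappa>\<^sup>2 * u\<^sup>2)"
    using d unfolding inv_stereo_tension(1)[OF dim d] by (simp add: u_def power_divide power_mult_distrib)
  then show ?thesis
    unfolding lap F_def[symmetric] \<tau>_def[symmetric] proj by simp
qed

text \<open>With \<open>y = \<kappa> |x|\<close> the polar angle is \<open>2 arctan y\<close>, whose sine and cosine are rational in \<open>y\<close>.\<close>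

lemma rot_map_eq_inv_stereo:
  fixes x :: "real^4"
  assumes \<kappa>: "\<kappa> > 0" and d: "d > 0"
    and \<beta>: "\<And>t. t \<le> ln (1 / \<kappa>) \<Longrightarrow> \<beta> t = 2 / d * arctan (\<kappa> * exp t)"
    and x: "x \<in> cball 0 (1 / \<kappa>)"
  shows "rot_map d \<beta> x = inv_stereo d \<kappa> x"
proof (cases "x = 0")
  case True
  then show ?thesis
    using d by (simp add: rot_map_def polar_def h_def inv_stereo_def radial_def weight_def)
next
  case False
  define y where "y = \<kappa> * norm x"
  have "ln (norm x) \<le> ln (1 / \<kappa>)"
    using False x \<kappa> by (subst ln_le_cancel_iff) auto
  then have "d * \<beta> (ln (norm x)) = 2 * arctan y"
    using \<beta> False d by (simp add: y_def)
  then have "rot_map d \<beta> x = ((2 * y / (1 + y\<^sup>2) / d) *\<^sub>R sgn x, (1 - y\<^sup>2) / (1 + y\<^sup>2) / d)"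
    using False by (simp add: rot_map_def polar_def h_def sin_double_arctan cos_double_arctan)
  moreover have w: "weight \<kappa> x = 1 / (1 + y\<^sup>2)"
    by (simp add: weight_def y_def power_mult_distrib power2_norm_eq_inner)
  moreover have "(2 * y / (1 + y\<^sup>2) / d) *\<^sub>R sgn x = (2 * \<kappa> / d * weight \<kappa> x) *\<^sub>R x"
    unfolding w using False by (simp add: y_def sgn_div_norm divide_simps)
  moreover have "(1 - y\<^sup>2) / (1 + y\<^sup>2) / d = 2 / d * weight \<kappa> x - 1 / d"
  proof -
    have "1 + y\<^sup>2 > 0"
      by (simp add: add_pos_nonneg)
    then have "(1 - y\<^sup>2) / (1 + y\<^sup>2) = 2 * weight \<kappa> x - 1"
      by (simp add: w field_simps)
    then show ?thesis
      by (simp add: diff_divide_distrib)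
  qed
  ultimately show ?thesis
    by (simp add: inv_stereo_def radial_def mult_ac)
qed

section \<open>The conformal map of the ball\<close>

theorem theorem5p4:
  fixes c d :: real and \<beta> :: "real \<Rightarrow> real"
  assumes "c > 0" and "d > 0"
    and "\<And>t. t \<le> ln (1 / c\<^sup>2) \<Longrightarrow> \<beta> t = 2 / d * arctan (c\<^sup>2 * exp t)"
  shows "\<beta> (ln (1 / c\<^sup>2)) = pi / (2 * d) \<and>
    conformal_on (cball 0 (1 / c\<^sup>2)) (rot_map d \<beta>) \<and>
    proper_biharmonic d (cball 0 (1 / c\<^sup>2)) (rot_map d \<beta>) \<and>
    equivariant_stable d (ln (1 / c\<^sup>2)) \<beta>"
proof -
  define \<kappa> where "\<kappa> = c\<^sup>2"
  define M where "M = cball (0 :: real^4) (1 / \<kappa>)"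
  define F where "F = (inv_stereo d \<kappa> :: real^4 \<Rightarrow> _)"
  have \<kappa>: "\<kappa> > 0"
    using assms(1) by (simp add: \<kappa>_def)
  note d = assms(2)
  note \<beta> = assms(3)[folded \<kappa>_def]
  have dim: "DIM(real^4) = 4"
    by simp
  have rot: "rot_map d \<beta> x = F x" if "x \<in> M" for x
    unfolding F_def by (rule rot_map_eq_inv_stereo[OF \<kappa> d \<beta>]) (use that in \<open>auto simp: M_def\<close>)
  have int: "interior M = ball 0 (1 / \<kappa>)" "interior M \<subseteq> M"
    by (auto simp: M_def interior_subset)
  have "\<beta> (ln (1 / \<kappa>)) = pi / (2 * d)"
    using \<beta>[of "ln (1 / \<kappa>)"] \<kappa> by (simp add: exp_ln arctan_one)
  moreover have "conformal_on M (rot_map d \<beta>)"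
    unfolding conformal_on_def
  proof
    fix x
    assume x: "x \<in> M"
    obtain D where D: "(F has_derivative D) (at x)"
      "\<And>v w. D v \<bullet> D w = (2 * \<kappa> * weight \<kappa> x / d)\<^sup>2 * (v \<bullet> w)"
      using inv_stereo_conformal[OF \<kappa> d, of x] unfolding F_def by metis
    have "(rot_map d \<beta> has_derivative D) (at x within M)"
      by (rule has_derivative_transform_within[OF has_derivative_at_withinI[OF D(1)], of 1]) (use x rot in auto)
    moreover have "2 * \<kappa> * weight \<kappa> x / d > 0"
      using \<kappa> d weight_denominator_pos[of \<kappa> x] by (simp add: weight_def)
    ultimately show "\<exists>D \<rho>. (rot_map d \<beta> has_derivative D) (at x within M) \<and> \<rho> > 0 \<and>
        (\<forall>u v. D u \<bullet> D v = \<rho>\<^sup>2 * (u \<bullet> v))"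
      using D(2) by blast
  qed
  moreover have "proper_biharmonic d M (rot_map d \<beta>)"
    unfolding proper_biharmonic_def
  proof (intro conjI allI impI)
    have smooth: "Ck_on k U F" for k U
      unfolding F_def inv_stereo_def by (rule Ck_on_radial_poly)
    show "smooth_on M (rot_map d \<beta>)"
      unfolding smooth_on_def using smooth rot by (intro exI[of _ UNIV] exI[of _ F]) auto
    show "rot_map d \<beta> ` M \<subseteq> sphere 0 (1 / d)"
      using rot norm_inv_stereo[OF d] by (auto simp: F_def)
    have tau: "tension d F = radial \<kappa> (poly [:0, 0, - 8 * \<kappa> ^ 3 / d, 16 * \<kappa> ^ 3 / d:])
        (poly [:0, 0, - 16 * \<kappa>\<^sup>2 / d, 16 * \<kappa>\<^sup>2 / d:])"
      using inv_stereo_tension(2)[OF dim d] by (auto simp: F_def)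
    have smooth_tau: "Ck_on k U (tension d F)" for k U
      unfolding tau by (rule Ck_on_radial_poly)
    have energy: "set_integrable lborel (interior M) (\<lambda>x. (norm (tension d F x))\<^sup>2)"
    proof (rule set_integrable_subset[OF _ _ int(2)])
      show "set_integrable lborel M (\<lambda>x. (norm (tension d F x))\<^sup>2)"
        unfolding set_integrable_def using Ck_on_imp_continuous_on[OF smooth_tau]
        by (intro borel_integrable_compact continuous_intros) (auto simp: M_def)
    qed simp
    show "((\<lambda>s. bienergy d (interior M) (\<Phi> s)) has_real_derivative 0) (at 0)"
      if var: "variation d (interior M) (rot_map d \<beta>) \<Phi> \<epsilon>" for \<Phi> \<epsilon>
    proof (rule first_variation_eq_0[OF _ d smooth smooth_tau energy])
      show "variation d (interior M) F \<Phi> \<epsilon>"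
        using var rot int(2) unfolding variation_def by (auto simp: subset_iff)
    qed (auto simp: F_def inv_stereo_biharmonic[OF dim d])
    \<comment> \<open>The tension field vanishes at the origin, so a different interior point is needed.\<close>
    define x :: "real^4" where "x = (1 / (2 * \<kappa>)) *\<^sub>R axis 1 1"
    have x: "norm x = 1 / (2 * \<kappa>)"
      using \<kappa> by (simp add: x_def)
    have w: "weight \<kappa> x = 4 / 5"
      using \<kappa> by (simp add: weight_def dot_square_norm x power2_eq_square)
    have "snd (tension d F x) \<noteq> 0"
      using \<kappa> d by (simp add: tau radial_def w field_simps)
    moreover have "tension d (rot_map d \<beta>) x = tension d F x"
      if "x \<in> interior M"
      using laplacian_cong_open[OF open_interior that, of "rot_map d \<beta>" F] rot int(2) that
      by (simp add: tension_eq subset_iff)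
    moreover have "x \<in> interior M"
      using \<kappa> by (simp add: int x divide_strict_left_mono)
    ultimately show "\<exists>x\<in>interior M. tension d (rot_map d \<beta>) x \<noteq> 0"
      by (metis zero_prod_def snd_conv)
  qed
  moreover have "equivariant_stable d (ln (1 / \<kappa>)) \<beta>"
    by (rule conformal_profile_stable[OF \<kappa> d \<beta>])
  ultimately show ?thesis
    unfolding M_def \<kappa>_def by blast
qed

end
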